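(* Consider the Gaussian white noise model with orthonormal basis $(\phi_k)_{k\ge1}$ of $L^2[0,1]$, the Gaussian prior $f=\sum_{k\ge1}f_k\phi_k$ with $f_k\sim\mathcal N(0,\lambda_k)$ independent, and the linear functional $\psi(f)=\int_0^1a(t)f(t)\,dt=\sum_ka_kf_k$. Suppose that for some $\beta,\mu,\gamma>0$ $$f_{0,k}=k^{-\frac12-\beta},\qquad a_k=k^{-\frac12-\mu},\qquad\lambda_k=k^{-1-2\gamma},$$ where $f_{0,k}$ are the coefficients of the true function $f_0$. Let $\alpha_n\in(0,1]$ with $n\alpha_n\to\infty$, let $\delta\in(0,1)$, let $\bar\psi$ be the mean (equivalently median) of the $\alpha_n$-posterior distribution of $\psi(f)$ and $a^Y_{n,u}$ its $u$-quantile, and let $$\mathcal J_{\alpha_n}=\Big(\sqrt{\alpha_n}\,(a^Y_{n,\delta/2}-\bar\psi)+\bar\psi\,,\ \sqrt{\alpha_n}\,(a^Y_{n,1-\delta/2}-\bar\psi)+\bar\psi\Big].$$ Then: 1. If $\beta+\mu>1+2\gamma$, the sets $\mathcal J_{\alpha_n}$ are efficient confidence intervals of level $1-\delta$ if and only if $\sqrt n\,\alpha_n\to\infty$. 2. If $\beta+\mu=1+2\gamma$, the sets $\mathcal J_{\alpha_n}$ are efficient confidence intervals of level $1-\delta$ if and only if $\frac{\sqrt n}{\log n}\alpha_n\to\infty$. 3. If $\frac12+\gamma<\beta+\mu<1+2\gamma$, the sets $\mathcal J_{\alpha_n}$ are efficient confidence intervals of level $1-\delta$ if and only if $n^{1-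\frac{1+2\gamma}{2(\beta+\mu)}}\alpha_n\to\infty$.
   Context: Gaussian white noise model: one observes $Y_k=f_k+\frac1{\sqrt n}\varepsilon_k$, $k\ge1$, with $f_k=\langle f,\phi_k\rangle_2$ and $\varepsilon_k$ i.i.d. $\mathcal N(0,1)$; $P_0$ is the law under $f_0$. The $\alpha_n$-posterior is $\Pi_{\alpha_n}(B\mid Y)=\int_Be^{\alpha_n\ell_n}d\Pi/\int e^{\alpha_n\ell_n}d\Pi$ with $\ell_n$ the log-likelihood. By conjugacy the $\alpha_n$-posterior distribution of $\psi(f)$ is $\mathcal N(\bar\psi,\bar\sigma^2)$ with $\bar\psi=\sum_k\frac{n\alpha_n\lambda_k}{1+n\alpha_n\lambda_k}a_kY_k$ and $\bar\sigma^2=\sum_k\frac{\lambda_k}{1+n\alpha_n\lambda_k}a_k^2$. "$\mathcal J_{\alpha_n}$ are efficient confidence intervals of level $1-\delta$" means $P_0[\psi(f_0)\in\mathcal J_{\alpha_n}]\to1-\delta$ as $n\to\infty$. *)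

theory Defs
  imports "HOL-Probability.Probability"
begin

text \<open>
  Sequences are indexed from 0: position k holds what is usually written with index k + 1.
  Elements of L2 are functions (not classes modulo null sets); everything below depends on
  them only up to Lebesgue-null sets.
\<close>

definition L2 :: "(real \<Rightarrow> real) set" where
  "L2 = {f. f \<in> borel_measurable (lebesgue_on {0..1}) \<and>
            integrable (lebesgue_on {0..1}) (\<lambda>t. (f t)\<^sup>2)}"

definition inner_L2 :: "(real \<Rightarrow> real) \<Rightarrow> (real \<Rightarrow> real) \<Rightarrow> real" where
  "inner_L2 f g = (LINT t|lebesgue_on {0..1}. f t * g t)"

definition coef :: "(nat \<Rightarrow> real \<Rightarrow> real) \<Rightarrow> (real \<Rightarrow> real) \<Rightarrow> nat \<Rightarrow> real" where
  "coef \<phi> f k = inner_L2 f (\<phi> k)"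

definition orthonormal_basis_L2 :: "(nat \<Rightarrow> real \<Rightarrow> real) \<Rightarrow> bool" where
  "orthonormal_basis_L2 \<phi> \<longleftrightarrow>
     (\<forall>k. \<phi> k \<in> L2) \<and>
     (\<forall>j k. inner_L2 (\<phi> j) (\<phi> k) = (if j = k then 1 else 0)) \<and>
     (\<forall>f\<in>L2. (\<lambda>N. LINT t|lebesgue_on {0..1}. (f t - (\<Sum>k<N. coef \<phi> f k * \<phi> k t))\<^sup>2)
                \<longlonglongrightarrow> 0)"

definition linear_functional :: "(real \<Rightarrow> real) \<Rightarrow> (real \<Rightarrow> real) \<Rightarrow> real" where
  "linear_functional a f = (LINT t|lebesgue_on {0..1}. a t * f t)"

text \<open>
  The law on L2 of a random series with independent N(0, lam k) coefficients in the basis.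
  The sigma-algebra is only required to make the coefficients measurable. Note that
  \<^const>\<open>normal_density\<close> takes the standard deviation.
\<close>

definition gaussian_series_prior ::
    "(nat \<Rightarrow> real \<Rightarrow> real) \<Rightarrow> (nat \<Rightarrow> real) \<Rightarrow> (real \<Rightarrow> real) measure \<Rightarrow> bool" where
  "gaussian_series_prior \<phi> lam prior \<longleftrightarrow>
     prob_space prior \<and> space prior = L2 \<and>
     prob_space.indep_vars prior (\<lambda>_. borel) (\<lambda>k f. coef \<phi> f k) UNIV \<and>
     (\<forall>k. distributed prior lborel (\<lambda>f. coef \<phi> f k) (normal_density 0 (sqrt (lam k))))"

definition white_noise_law ::
    "(nat \<Rightarrow> real \<Rightarrow> real) \<Rightarrow> nat \<Rightarrow> (real \<Rightarrow> real) \<Rightarrow> (nat \<Rightarrow> real) measure" where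
  "white_noise_law \<phi> n f =
     distr (\<Pi>\<^sub>M k\<in>UNIV. std_normal_distribution) (\<Pi>\<^sub>M k\<in>UNIV. borel)
       (\<lambda>\<epsilon> k. coef \<phi> f k + \<epsilon> k / sqrt (real n))"

text \<open>
  Log-density of the law under f with respect to the pure noise law (f = 0), by the
  Cameron-Martin formula. The series converges only conditionally in general: for almost
  every observation Y it converges for almost every f under the prior.
\<close>

definition log_likelihood ::
    "(nat \<Rightarrow> real \<Rightarrow> real) \<Rightarrow> nat \<Rightarrow> (nat \<Rightarrow> real) \<Rightarrow> (real \<Rightarrow> real) \<Rightarrow> real" where
  "log_likelihood \<phi> n Y f =
     real n * (\<Sum>k. coef \<phi> f k * Y k) - real n / 2 * inner_L2 f f"

definition frac_posterior ::
    "(real \<Rightarrow> real) measure \<Rightarrow> (nat \<Rightarrow> real \<Rightarrow> real) \<Rightarrow> real \<Rightarrow> nat \<Rightarrow> (nat \<Rightarrow> real)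
       \<Rightarrow> (real \<Rightarrow> real) measure" where
  "frac_posterior prior \<phi> \<alpha> n Y =
     density prior (\<lambda>f. ennreal (exp (\<alpha> * log_likelihood \<phi> n Y f)) /
                    (\<integral>\<^sup>+g. ennreal (exp (\<alpha> * log_likelihood \<phi> n Y g)) \<partial>prior))"

definition functional_posterior ::
    "(real \<Rightarrow> real) measure \<Rightarrow> (nat \<Rightarrow> real \<Rightarrow> real) \<Rightarrow> (real \<Rightarrow> real) \<Rightarrow> real \<Rightarrow> nat
       \<Rightarrow> (nat \<Rightarrow> real) \<Rightarrow> real measure" where
  "functional_posterior prior \<phi> a \<alpha> n Y =
     distr (frac_posterior prior \<phi> \<alpha> n Y) borel (linear_functional a)"

definition quantile :: "real measure \<Rightarrow> real \<Rightarrow> real" where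
  "quantile \<nu> u = Inf {x. u \<le> cdf \<nu> x}"

definition mean :: "real measure \<Rightarrow> real" where
  "mean \<nu> = (LINT x|\<nu>. x)"

definition corrected_interval :: "real \<Rightarrow> real \<Rightarrow> real measure \<Rightarrow> real set" where
  "corrected_interval \<alpha> \<delta> \<nu> =
     {sqrt \<alpha> * (quantile \<nu> (\<delta> / 2) - mean \<nu>) + mean \<nu> <..
      sqrt \<alpha> * (quantile \<nu> (1 - \<delta> / 2) - mean \<nu>) + mean \<nu>}"

definition efficient_intervals ::
    "(real \<Rightarrow> real) measure \<Rightarrow> (nat \<Rightarrow> real \<Rightarrow> real) \<Rightarrow> (real \<Rightarrow> real) \<Rightarrow> (real \<Rightarrow> real)
       \<Rightarrow> (nat \<Rightarrow> real) \<Rightarrow> real \<Rightarrow> bool" where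
  "efficient_intervals prior \<phi> a f0 \<alpha> \<delta> \<longleftrightarrow>
     (\<lambda>n. measure (white_noise_law \<phi> n f0)
            {Y \<in> space (white_noise_law \<phi> n f0).
               linear_functional a f0 \<in>
                 corrected_interval (\<alpha> n) \<delta> (functional_posterior prior \<phi> a (\<alpha> n) n Y)})
       \<longlonglongrightarrow> 1 - \<delta>"

end

(*
  Proof idea.  In the coefficient sequence the prior is a product of normals, and the likelihood
  multiplies it by exp(kappa (sum_k f_k Y_k) - kappa/2 (sum_k f_k^2)) with kappa = n alpha.  The
  partial products are bounded in L2 of the prior and converge almost surely (by Ottaviani's
  inequality, as sum_k f_k Y_k converges only conditionally), so the characteristic function of
  the posterior of psi(f) is a limit of finite products of Gaussian integrals; this yields the
  normal posterior.  Consequently the coverage equals Phi(B + rho z) - Phi(B - rho z), where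
  rho -> 1 and B is, up to a convergent positive factor, sqrt n times the bias
  sum_k a_k f_k / (1 + kappa lam_k).  Since Phi(B + z) - Phi(B - z) is strictly decreasing in
  B >= 0, the intervals are efficient iff B -> 0, and the bias is of order 1/kappa,
  log kappa / kappa or kappa^(-(beta+mu)/(1+2 gamma)) in the three regimes.
*)
theory Submission
  imports Defs
begin

section \<open>Parseval's identity in \<open>L2\<close>\<close>

text \<open>Put w_k = \<kappa> \<lambda>_k / (1 + \<kappa> \<lambda>_k). The posterior variance of
  psi(f) is the sum of w_k a_k^2 divided by \<kappa>, and the factor sqrt \<alpha> in the corrected
  interval replaces this \<kappa> by n. The sampling variance of the posterior mean is the sum of
  w_k^2 a_k^2 divided by n. Both sums tend to the sum of a_k^2, because every w_k tends to 1: hence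
  rho tends to 1 and the bias alone decides. As the coefficients of f0 and a are positive, nothing
  cancels in the bias, and its order can be read off from blocks of terms.

  The data enter only through the finiteness of the sum of \<lambda>_k Y_k^2, a condition weaker
  than square summability that holds for almost every noise. For each fixed Y of this kind the
  conjugacy computation is a statement about the prior alone. The normalising constant, an infinite
  product, is never evaluated: it is the limit at frequency 0 of the same truncated integrals whose
  limit at frequency u gives the characteristic function.\<close>

lemma L2_measurable: "f \<in> L2 \<Longrightarrow> f \<in> borel_measurable (lebesgue_on {0..1})"
  by (simp add: L2_def)

lemma L2_integrable_mult:
  assumes "f \<in> L2" "g \<in> L2"
  shows "integrable (lebesgue_on {0..1}) (\<lambda>t. f t * g t)"
proof (rule Bochner_Integration.integrable_bound)
  show "integrable (lebesgue_on {0..1}) (\<lambda>t. (f t)\<^sup>2 + (g t)\<^sup>2)"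
    using assms by (auto simp: L2_def)
  show "(\<lambda>t. f t * g t) \<in> borel_measurable (lebesgue_on {0..1})"
    using assms[THEN L2_measurable] by measurable
  have "\<bar>x * y\<bar> \<le> x\<^sup>2 + y\<^sup>2" for x y :: real
  proof -
    have "0 \<le> \<bar>x\<bar> * \<bar>y\<bar>" by simp
    then show ?thesis
      using sum_squares_bound[of "\<bar>x\<bar>" "\<bar>y\<bar>"] unfolding abs_mult power2_abs by linarith
  qed
  then show "AE t in lebesgue_on {0..1}. norm (f t * g t) \<le> norm ((f t)\<^sup>2 + (g t)\<^sup>2)"
    by (auto intro!: AE_I2 simp: order_trans[OF _ abs_ge_self])
qed

lemma L2_add: assumes "f \<in> L2" "g \<in> L2" shows "(\<lambda>t. f t + g t) \<in> L2"
proof -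
  have "integrable (lebesgue_on {0..1}) (\<lambda>t. f t * f t + 2 * (f t * g t) + g t * g t)"
    using assms by (intro Bochner_Integration.integrable_add integrable_mult_right L2_integrable_mult)
  then show ?thesis
    using assms[THEN L2_measurable] by (auto simp: L2_def power2_eq_square algebra_simps)
qed

lemma inner_L2_add_left:
  assumes "f \<in> L2" "g \<in> L2" "h \<in> L2"
  shows "inner_L2 (\<lambda>t. f t + g t) h = inner_L2 f h + inner_L2 g h"
  using L2_integrable_mult[OF assms(1,3)] L2_integrable_mult[OF assms(2,3)]
  by (simp add: inner_L2_def distrib_right)

lemma inner_L2_commute: "inner_L2 f g = inner_L2 g f"
  by (simp add: inner_L2_def mult.commute)

text \<open>Orthonormality turns the squared distance of f to its N-th partial sum into
  \<open>inner_L2 f f\<close> minus the first N squared coefficients, and the completeness clause of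
  the basis sends that distance to 0.\<close>

lemma coef_square_sums:
  assumes basis: "orthonormal_basis_L2 \<phi>" and f: "f \<in> L2"
  shows "(\<lambda>k. (coef \<phi> f k)\<^sup>2) sums inner_L2 f f"
proof -
  note \<phi> = basis[unfolded orthonormal_basis_L2_def]
  have \<phi>L2: "\<phi> k \<in> L2" for k using \<phi> by blast
  have on: "inner_L2 (\<phi> j) (\<phi> k) = (if j = k then 1 else 0)" for j k using \<phi> by blast
  let ?c = "coef \<phi> f"
  have residual: "(LINT t|lebesgue_on {0..1}. (f t - (\<Sum>k<N. ?c k * \<phi> k t))\<^sup>2)
      = inner_L2 f f - (\<Sum>k<N. (?c k)\<^sup>2)" for N
  proof -
    have "(f t - (\<Sum>k<N. ?c k * \<phi> k t))\<^sup>2 = f t * f t - 2 * (\<Sum>k<N. ?c k * (f t * \<phi> k t))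
       + (\<Sum>j<N. \<Sum>k<N. ?c j * ?c k * (\<phi> j t * \<phi> k t))" for t
      by (simp add: power2_diff power2_eq_square sum_product sum_distrib_left algebra_simps)
    then have "(LINT t|lebesgue_on {0..1}. (f t - (\<Sum>k<N. ?c k * \<phi> k t))\<^sup>2)
       = (LINT t|lebesgue_on {0..1}. f t * f t - 2 * (\<Sum>k<N. ?c k * (f t * \<phi> k t))
       + (\<Sum>j<N. \<Sum>k<N. ?c j * ?c k * (\<phi> j t * \<phi> k t)))" by simp
    also have "\<dots> = inner_L2 f f - 2 * (\<Sum>k<N. ?c k * ?c k)
       + (\<Sum>j<N. \<Sum>k<N. ?c j * ?c k * inner_L2 (\<phi> j) (\<phi> k))"
      using f \<phi>L2 by (simp add: L2_integrable_mult integral_sum inner_L2_def coef_def)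
    also have "\<dots> = inner_L2 f f - (\<Sum>k<N. (?c k)\<^sup>2)"
      by (simp add: on if_distrib power2_eq_square cong: if_cong)
    finally show ?thesis .
  qed
  have "(\<lambda>N. LINT t|lebesgue_on {0..1}. (f t - (\<Sum>k<N. ?c k * \<phi> k t))\<^sup>2) \<longlonglongrightarrow> 0"
    using \<phi> f by blast
  then have "(\<lambda>N. inner_L2 f f - (\<Sum>k<N. (?c k)\<^sup>2)) \<longlonglongrightarrow> 0"
    unfolding residual .
  then have "(\<lambda>N. inner_L2 f f - (inner_L2 f f - (\<Sum>k<N. (?c k)\<^sup>2))) \<longlonglongrightarrow> inner_L2 f f - 0"
    by (intro tendsto_intros)
  then show ?thesis by (simp add: sums_def)
qed

text \<open>Polarisation of the square case, applied to f + g, f and g. It turns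
  \<open>linear_functional a\<close> into a series in the coefficients of f, whose measurability and
  joint law under the prior are known.\<close>

lemma coef_mult_sums:
  assumes basis: "orthonormal_basis_L2 \<phi>" and f: "f \<in> L2" and g: "g \<in> L2"
  shows "(\<lambda>k. coef \<phi> f k * coef \<phi> g k) sums inner_L2 f g"
proof -
  let ?h = "\<lambda>t. f t + g t"
  have h: "?h \<in> L2" using f g by (rule L2_add)
  have "coef \<phi> ?h k = coef \<phi> f k + coef \<phi> g k" for k
    using basis f g by (simp add: coef_def inner_L2_add_left orthonormal_basis_L2_def)
  then have "(\<lambda>k. ((coef \<phi> ?h k)\<^sup>2 - (coef \<phi> f k)\<^sup>2 - (coef \<phi> g k)\<^sup>2) / 2)
     = (\<lambda>k. coef \<phi> f k * coef \<phi> g k)"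
    by (auto simp: power2_eq_square algebra_simps)
  moreover have "inner_L2 ?h ?h = inner_L2 f f + 2 * inner_L2 f g + inner_L2 g g"
    using inner_L2_add_left[OF f g h] inner_L2_add_left[OF f g f] inner_L2_add_left[OF f g g]
      inner_L2_commute[of f ?h] inner_L2_commute[of g ?h] inner_L2_commute[of g f] by linarith
  moreover have "(\<lambda>k. ((coef \<phi> ?h k)\<^sup>2 - (coef \<phi> f k)\<^sup>2 - (coef \<phi> g k)\<^sup>2) / 2)
     sums ((inner_L2 ?h ?h - inner_L2 f f - inner_L2 g g) / 2)"
    by (intro sums_divide sums_diff coef_square_sums basis f g h)
  ultimately show ?thesis by simp
qed

section \<open>Almost sure convergence of independent series\<close>

context prob_space
begin

text \<open>Cross terms vanish: \<open>X i\<close> is centred and independent of the sum over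
  J.\<close>

lemma
  fixes X :: "nat \<Rightarrow> 'a \<Rightarrow> real"
  assumes ind: "indep_vars (\<lambda>_. borel) X UNIV"
    and sq: "\<And>k. integrable M (\<lambda>\<omega>. (X k \<omega>)\<^sup>2)" and mean0: "\<And>k. expectation (X k) = 0"
    and I: "finite I"
  shows integrable_square_sum_indep: "integrable M (\<lambda>\<omega>. (\<Sum>k\<in>I. X k \<omega>)\<^sup>2)"
    and expectation_square_sum_indep:
      "expectation (\<lambda>\<omega>. (\<Sum>k\<in>I. X k \<omega>)\<^sup>2) = (\<Sum>k\<in>I. expectation (\<lambda>\<omega>. (X k \<omega>)\<^sup>2))"
proof -
  have rv [measurable]: "random_variable borel (X k)" for k
    using ind by (auto simp: indep_vars_def)
  have int: "integrable M (X k)" for k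
    using square_integrable_imp_integrable[OF rv sq] .
  have "integrable M (\<lambda>\<omega>. (\<Sum>k\<in>I. X k \<omega>)\<^sup>2) \<and>
      expectation (\<lambda>\<omega>. (\<Sum>k\<in>I. X k \<omega>)\<^sup>2) = (\<Sum>k\<in>I. expectation (\<lambda>\<omega>. (X k \<omega>)\<^sup>2))"
    using I
  proof induction
    case (insert i J)
    let ?S = "\<lambda>\<omega>. \<Sum>k\<in>J. X k \<omega>"
    have iv: "indep_var borel (X i) borel ?S"
      using insert by (intro indep_vars_sum indep_vars_subset[OF ind]) auto
    have S: "integrable M ?S" using int by simp
    note prod = indep_var_integrable[OF iv int S]
    have "expectation (\<lambda>\<omega>. X i \<omega> * ?S \<omega>) = 0"
      by (simp only: indep_var_lebesgue_integral[OF iv int S] mean0 mult_zero_left)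
    moreover have "(\<lambda>\<omega>. (\<Sum>k\<in>insert i J. X k \<omega>)\<^sup>2)
        = (\<lambda>\<omega>. (X i \<omega>)\<^sup>2 + 2 * (X i \<omega> * ?S \<omega>) + (?S \<omega>)\<^sup>2)"
      using insert by (auto simp: power2_sum)
    ultimately show ?case
      using insert sq[of i] prod by simp
  qed auto
  then show "integrable M (\<lambda>\<omega>. (\<Sum>k\<in>I. X k \<omega>)\<^sup>2)"
    "expectation (\<lambda>\<omega>. (\<Sum>k\<in>I. X k \<omega>)\<^sup>2) = (\<Sum>k\<in>I. expectation (\<lambda>\<omega>. (X k \<omega>)\<^sup>2))"
    by auto
qed

text \<open>Stop at the first k where the partial sum exceeds 2x. If the remaining block from k to m
  is at most x in modulus, the full sum still exceeds x. That block is independent of everything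
  before k and obeys the bound with probability at least 1/2, so at least half of each
  first-crossing event lies in the event on the right.\<close>

lemma ottaviani_inequality:
  fixes X :: "nat \<Rightarrow> 'a \<Rightarrow> real"
  assumes ind: "indep_vars (\<lambda>_. borel) X UNIV"
    and tail: "\<And>k. k \<in> {N..m} \<Longrightarrow> prob {\<omega>\<in>space M. \<bar>\<Sum>i\<in>{k..<m}. X i \<omega>\<bar> \<le> x} \<ge> 1 / 2"
  shows "prob {\<omega>\<in>space M. \<exists>k\<in>{N..m}. \<bar>\<Sum>i\<in>{N..<k}. X i \<omega>\<bar> > 2 * x}
     \<le> 2 * prob {\<omega>\<in>space M. \<bar>\<Sum>i\<in>{N..<m}. X i \<omega>\<bar> > x}"
proof -
  have rv [measurable]: "random_variable borel (X k)" for k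
    using ind by (auto simp: indep_vars_def)
  \<comment> \<open>decompose according to the first partial sum that exceeds the level\<close>
  define A where "A k = {\<omega>\<in>space M. \<bar>\<Sum>i\<in>{N..<k}. X i \<omega>\<bar> > 2 * x \<and>
      (\<forall>j\<in>{N..<k}. \<bar>\<Sum>i\<in>{N..<j}. X i \<omega>\<bar> \<le> 2 * x)}" for k
  define B where "B k = {\<omega>\<in>space M. \<bar>\<Sum>i\<in>{k..<m}. X i \<omega>\<bar> \<le> x}" for k
  have A_meas: "A k \<in> events" and B_meas: "B k \<in> events" for k
    unfolding A_def B_def by measurable
  have disj: "disjoint_family_on A {N..m}"
  proof -
    have "A j \<inter> A k = {}" if "N \<le> j" "j < k" for j k
      using that by (force simp: A_def)
    then show ?thesis
      unfolding disjoint_family_on_def by (metis Int_commute atLeastAtMost_iff nat_neq_iff)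
  qed
  have disj': "disjoint_family_on (\<lambda>k. A k \<inter> B k) {N..m}"
    using disj unfolding disjoint_family_on_def by blast
  have half: "prob (A k) / 2 \<le> prob (A k \<inter> B k)" if k: "k \<in> {N..m}" for k
  proof -
    let ?P = "\<lambda>J. \<Pi>\<^sub>M i\<in>J. (borel :: real measure)"
    let ?r = "\<lambda>J \<omega>. restrict (\<lambda>i. X i \<omega>) J"
    \<comment> \<open>Both events are pulled back from product spaces over the disjoint index blocks
      \<open>{N..<k}\<close> and \<open>{k..<m}\<close>, so that independence of blocks applies to
      them.\<close>
    have iv: "indep_var (?P {N..<k}) (?r {N..<k}) (?P {k..<m}) (?r {k..<m})"
      by (rule indep_var_restrict[OF ind]) auto
    define A' where "A' = {w \<in> space (?P {N..<k}). \<bar>\<Sum>i\<in>{N..<k}. w i\<bar> > 2 * x \<and>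
      (\<forall>j\<in>{N..<k}. \<bar>\<Sum>i\<in>{N..<j}. w i\<bar> \<le> 2 * x)}"
    define B' where "B' = {w \<in> space (?P {k..<m}). \<bar>\<Sum>i\<in>{k..<m}. w i\<bar> \<le> x}"
    have sum_meas: "(\<lambda>w. \<Sum>i\<in>{a..<b}. w i) \<in> borel_measurable (?P J)" if "{a..<b} \<subseteq> J"
      for a b :: nat and J
      using that by (intro borel_measurable_sum measurable_component_singleton) auto
    have "A' \<in> sets (?P {N..<k})"
      unfolding A'_def using k
      by (intro sets.sets_Collect_conj sets.sets_Collect_finite_All borel_measurable_less
          borel_measurable_le borel_measurable_abs sum_meas) auto
    moreover have "B' \<in> sets (?P {k..<m})"
      unfolding B'_def by (intro borel_measurable_le borel_measurable_abs sum_meas) auto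
    ultimately have "prob ((\<lambda>\<omega>. (?r {N..<k} \<omega>, ?r {k..<m} \<omega>)) -` (A' \<times> B') \<inter> space M)
      = prob (?r {N..<k} -` A' \<inter> space M) * prob (?r {k..<m} -` B' \<inter> space M)"
      by (rule indep_varD[OF iv])
    moreover have "?r {N..<k} -` A' \<inter> space M = A k"
      by (auto simp: A'_def A_def space_PiM)
    moreover have "?r {k..<m} -` B' \<inter> space M = B k"
      by (auto simp: B'_def B_def space_PiM)
    moreover have "(\<lambda>\<omega>. (?r {N..<k} \<omega>, ?r {k..<m} \<omega>)) -` (A' \<times> B') \<inter> space M
        = (?r {N..<k} -` A' \<inter> space M) \<inter> (?r {k..<m} -` B' \<inter> space M)"
      by auto
    ultimately have "prob (A k \<inter> B k) = prob (A k) * prob (B k)"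
      by simp
    then show ?thesis
      using mult_left_mono[OF tail[OF k], of "prob (A k)"] by (simp add: B_def)
  qed
  have "{\<omega>\<in>space M. \<exists>k\<in>{N..m}. \<bar>\<Sum>i\<in>{N..<k}. X i \<omega>\<bar> > 2 * x} \<subseteq> (\<Union>k\<in>{N..m}. A k)"
  proof
    fix \<omega> assume "\<omega> \<in> {\<omega>\<in>space M. \<exists>k\<in>{N..m}. \<bar>\<Sum>i\<in>{N..<k}. X i \<omega>\<bar> > 2 * x}"
    then have \<omega>: "\<omega> \<in> space M" and ex: "\<exists>k. k \<in> {N..m} \<and> \<bar>\<Sum>i\<in>{N..<k}. X i \<omega>\<bar> > 2 * x" by auto
    define k where "k = (LEAST k. k \<in> {N..m} \<and> \<bar>\<Sum>i\<in>{N..<k}. X i \<omega>\<bar> > 2 * x)"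
    have k: "k \<in> {N..m}" "\<bar>\<Sum>i\<in>{N..<k}. X i \<omega>\<bar> > 2 * x"
      unfolding k_def using LeastI_ex[OF ex] by auto
    moreover have "\<bar>\<Sum>i\<in>{N..<j}. X i \<omega>\<bar> \<le> 2 * x" if "j \<in> {N..<k}" for j
      using not_less_Least[of j "\<lambda>k. k \<in> {N..m} \<and> \<bar>\<Sum>i\<in>{N..<k}. X i \<omega>\<bar> > 2 * x"] that k
      unfolding k_def[symmetric] by auto
    ultimately show "\<omega> \<in> (\<Union>k\<in>{N..m}. A k)" using \<omega> by (auto simp: A_def)
  qed
  then have "prob {\<omega>\<in>space M. \<exists>k\<in>{N..m}. \<bar>\<Sum>i\<in>{N..<k}. X i \<omega>\<bar> > 2 * x}
      \<le> prob (\<Union>k\<in>{N..m}. A k)"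
    using A_meas by (intro finite_measure_mono) auto
  also have "\<dots> = (\<Sum>k\<in>{N..m}. prob (A k))"
    using A_meas disj by (intro finite_measure_finite_Union) auto
  also have "\<dots> \<le> (\<Sum>k\<in>{N..m}. 2 * prob (A k \<inter> B k))"
    using half by (intro sum_mono) fastforce
  also have "\<dots> = 2 * prob (\<Union>k\<in>{N..m}. A k \<inter> B k)"
    using A_meas B_meas disj'
    by (subst finite_measure_finite_Union) (auto simp: sum_distrib_left)
  also have "\<dots> \<le> 2 * prob {\<omega>\<in>space M. \<bar>\<Sum>i\<in>{N..<m}. X i \<omega>\<bar> > x}"
  proof -
    have "A k \<inter> B k \<subseteq> {\<omega>\<in>space M. \<bar>\<Sum>i\<in>{N..<m}. X i \<omega>\<bar> > x}" if k: "k \<in> {N..m}" for k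
    proof -
      have "(\<Sum>i\<in>{N..<m}. X i \<omega>) = (\<Sum>i\<in>{N..<k}. X i \<omega>) + (\<Sum>i\<in>{k..<m}. X i \<omega>)" for \<omega>
        using k by (simp add: sum.atLeastLessThan_concat)
      then show ?thesis by (auto simp: A_def B_def)
    qed
    then have "(\<Union>k\<in>{N..m}. A k \<inter> B k) \<subseteq> {\<omega>\<in>space M. \<bar>\<Sum>i\<in>{N..<m}. X i \<omega>\<bar> > x}" by blast
    then show ?thesis
      by (intro mult_left_mono finite_measure_mono) auto
  qed
  finally show ?thesis .
qed

text \<open>Kolmogorov's one-series theorem. Chebyshev's inequality controls single block sums,
  Ottaviani's inequality upgrades this to the maximum over a block, and the vanishing variance tail
  then makes the partial sums Cauchy.\<close>

theorem AE_summable_indep: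
  fixes X :: "nat \<Rightarrow> 'a \<Rightarrow> real"
  assumes ind: "indep_vars (\<lambda>_. borel) X UNIV"
    and sq: "\<And>k. integrable M (\<lambda>\<omega>. (X k \<omega>)\<^sup>2)" and mean0: "\<And>k. expectation (X k) = 0"
    and var: "summable (\<lambda>k. expectation (\<lambda>\<omega>. (X k \<omega>)\<^sup>2))"
  shows "AE \<omega> in M. summable (\<lambda>k. X k \<omega>)"
proof -
  have rv [measurable]: "random_variable borel (X k)" for k
    using ind by (auto simp: indep_vars_def)
  have int: "integrable M (X k)" for k
    using square_integrable_imp_integrable[OF rv sq] .
  define v where "v k = expectation (\<lambda>\<omega>. (X k \<omega>)\<^sup>2)" for k
  have v_nonneg: "v k \<ge> 0" for k by (simp add: v_def)
  have v: "summable v" using var by (simp add: v_def[abs_def])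
  \<comment> \<open>The bound depends on N but not on the block, so it serves twice below: as the
    hypothesis of Ottaviani's inequality for all k at once, and as a bound on its right-hand
    side.\<close>
  have cheb: "prob {\<omega>\<in>space M. \<bar>\<Sum>i\<in>{k..<m}. X i \<omega>\<bar> \<ge> x} \<le> (\<Sum>i. v (i + N)) / x\<^sup>2"
    if "x > 0" "N \<le> k" for x k m N
  proof -
    have "prob {\<omega>\<in>space M. \<bar>(\<Sum>i\<in>{k..<m}. X i \<omega>) - expectation (\<lambda>\<omega>. \<Sum>i\<in>{k..<m}. X i \<omega>)\<bar> \<ge> x}
       \<le> variance (\<lambda>\<omega>. \<Sum>i\<in>{k..<m}. X i \<omega>) / x\<^sup>2"
      using that by (intro Chebyshev_inequality integrable_square_sum_indep[OF ind sq mean0]) auto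
    moreover have "expectation (\<lambda>\<omega>. \<Sum>i\<in>{k..<m}. X i \<omega>) = 0"
      using int by (simp add: mean0)
    ultimately have "prob {\<omega>\<in>space M. \<bar>\<Sum>i\<in>{k..<m}. X i \<omega>\<bar> \<ge> x}
       \<le> (\<Sum>i\<in>{k..<m}. v i) / x\<^sup>2"
      by (simp add: expectation_square_sum_indep[OF ind sq mean0] v_def)
    also have "(\<Sum>i\<in>{k..<m}. v i) \<le> (\<Sum>i. v (i + N))"
    proof -
      have "(\<Sum>i\<in>{k..<m}. v i) \<le> (\<Sum>i\<in>{N..<N+m}. v i)"
        using that v_nonneg by (intro sum_mono2) auto
      also have "\<dots> = (\<Sum>i<m. v (i + N))"
        by (rule sum.reindex_bij_witness[of _ "\<lambda>i. i + N" "\<lambda>i. i - N"]) auto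
      also have "\<dots> \<le> (\<Sum>i. v (i + N))"
        using v v_nonneg by (intro sum_le_suminf) (auto simp: summable_iff_shift)
      finally show ?thesis .
    qed
    finally show ?thesis using that by (simp add: divide_right_mono)
  qed
  have tails: "(\<lambda>N. \<Sum>i. v (i + N)) \<longlonglongrightarrow> 0"
    using v by (rule suminf_exist_split2)
  have AE_eps: "AE \<omega> in M. \<exists>N. \<forall>k\<ge>N. \<bar>\<Sum>i\<in>{N..<k}. X i \<omega>\<bar> \<le> 2 * x" if x: "x > 0" for x
  proof -
    define E where "E N = {\<omega>\<in>space M. \<exists>k\<ge>N. \<bar>\<Sum>i\<in>{N..<k}. X i \<omega>\<bar> > 2 * x}" for N
    have [measurable]: "E N \<in> events" for N unfolding E_def by measurable
    \<comment> \<open>With this smallness Chebyshev's bound is at most 1/2, which is what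
      Ottaviani's inequality asks of the remaining blocks.\<close>
    have E_le: "prob (E N) \<le> 2 * ((\<Sum>i. v (i + N)) / x\<^sup>2)" if small: "(\<Sum>i. v (i + N)) / x\<^sup>2 \<le> 1 / 2" for N
    proof -
      define F where "F m = {\<omega>\<in>space M. \<exists>k\<in>{N..N+m}. \<bar>\<Sum>i\<in>{N..<k}. X i \<omega>\<bar> > 2 * x}" for m
      have F_le: "prob (F m) \<le> 2 * ((\<Sum>i. v (i + N)) / x\<^sup>2)" for m
      proof -
        have "prob (F m) \<le> 2 * prob {\<omega>\<in>space M. \<bar>\<Sum>i\<in>{N..<N+m}. X i \<omega>\<bar> > x}"
          unfolding F_def
        proof (rule ottaviani_inequality[OF ind])
          fix k assume k: "k \<in> {N..N+m}"
          have "prob {\<omega>\<in>space M. \<bar>\<Sum>i\<in>{k..<N+m}. X i \<omega>\<bar> > x}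
              \<le> prob {\<omega>\<in>space M. \<bar>\<Sum>i\<in>{k..<N+m}. X i \<omega>\<bar> \<ge> x}"
            by (intro finite_measure_mono) auto
          also have "\<dots> \<le> 1 / 2"
            using cheb[OF x, of N k "N+m"] k small by (meson atLeastAtMost_iff order_trans)
          finally have "1 - 1 / 2 \<le> 1 - prob {\<omega>\<in>space M. \<bar>\<Sum>i\<in>{k..<N+m}. X i \<omega>\<bar> > x}"
            by simp
          also have "\<dots> = prob (space M - {\<omega>\<in>space M. \<bar>\<Sum>i\<in>{k..<N+m}. X i \<omega>\<bar> > x})"
            by (subst prob_compl) auto
          also have "space M - {\<omega>\<in>space M. \<bar>\<Sum>i\<in>{k..<N+m}. X i \<omega>\<bar> > x}
              = {\<omega>\<in>space M. \<bar>\<Sum>i\<in>{k..<N+m}. X i \<omega>\<bar> \<le> x}" by auto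
          finally show "1 / 2 \<le> prob {\<omega>\<in>space M. \<bar>\<Sum>i\<in>{k..<N+m}. X i \<omega>\<bar> \<le> x}" by simp
        qed
        also have "prob {\<omega>\<in>space M. \<bar>\<Sum>i\<in>{N..<N+m}. X i \<omega>\<bar> > x}
            \<le> prob {\<omega>\<in>space M. \<bar>\<Sum>i\<in>{N..<N+m}. X i \<omega>\<bar> \<ge> x}"
          by (intro finite_measure_mono) auto
        also note cheb[OF x, of N N "N+m"]
        finally show ?thesis by simp
      qed
      \<comment> \<open>The finite horizons increase to \<open>E N\<close>, and their bound does not
        depend on m.\<close>
      have "(\<lambda>m. prob (F m)) \<longlonglongrightarrow> prob (\<Union>m. F m)"
        by (intro finite_Lim_measure_incseq) (auto simp: F_def incseq_def)
      moreover have "(\<Union>m. F m) = E N"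
      proof -
        have "\<exists>m. k \<in> {N..N+m}" if "k \<ge> N" for k
          using that by (intro exI[of _ k]) auto
        then show ?thesis by (fastforce simp: F_def E_def)
      qed
      ultimately show ?thesis
        using F_le by (auto intro: LIMSEQ_le_const2)
    qed
    have "(\<lambda>N. (\<Sum>i. v (i + N)) / x\<^sup>2) \<longlonglongrightarrow> 0"
      using tendsto_divide[OF tails tendsto_const[of "x\<^sup>2"]] x by simp
    then have lim: "(\<lambda>N. 2 * ((\<Sum>i. v (i + N)) / x\<^sup>2)) \<longlonglongrightarrow> 0"
      and ev: "eventually (\<lambda>N. (\<Sum>i. v (i + N)) / x\<^sup>2 < 1 / 2) sequentially"
      by (rule tendsto_mult_right_zero, rule order_tendstoD) simp
    have "prob (\<Inter>N. E N) \<le> 2 * ((\<Sum>i. v (i + N)) / x\<^sup>2)"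
      if "(\<Sum>i. v (i + N)) / x\<^sup>2 < 1 / 2" for N
      using that by (intro order_trans[OF finite_measure_mono E_le]) auto
    then have le: "eventually (\<lambda>N. prob (\<Inter>N. E N) \<le> 2 * ((\<Sum>i. v (i + N)) / x\<^sup>2)) sequentially"
      using ev by (rule eventually_mono[rotated])
    have "(\<lambda>_. prob (\<Inter>N. E N)) \<longlonglongrightarrow> 0"
      by (rule tendsto_sandwich[OF _ le tendsto_const lim]) simp
    then have "prob (\<Inter>N. E N) = 0" by (simp add: LIMSEQ_const_iff)
    then have "AE \<omega> in M. \<omega> \<notin> (\<Inter>N. E N)"
      by (intro AE_not_in) (auto simp: null_setsI emeasure_eq_measure)
    then show ?thesis
      using AE_space by eventually_elim (force simp: E_def not_less)
  qed
  have "AE \<omega> in M. \<forall>j. \<exists>N. \<forall>k\<ge>N. \<bar>\<Sum>i\<in>{N..<k}. X i \<omega>\<bar> \<le> 2 * inverse (real (Suc j))"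
    by (subst AE_all_countable) (auto intro!: AE_eps)
  then show ?thesis
  proof eventually_elim
    case (elim \<omega>)
    show ?case
      unfolding summable_Cauchy
    proof (intro allI impI)
      fix e :: real assume "e > 0"
      \<comment> \<open>Two increments counted from N, each at most 2 / (j + 1), must together stay
        below e; hence e / 4.\<close>
      then obtain j where j: "inverse (real (Suc j)) < e / 4"
        using reals_Archimedean[of "e / 4"] by auto
      obtain N where N: "\<And>k. k \<ge> N \<Longrightarrow> \<bar>\<Sum>i\<in>{N..<k}. X i \<omega>\<bar> \<le> 2 * inverse (real (Suc j))"
        using elim by blast
      have "norm (\<Sum>i\<in>{m..<n}. X i \<omega>) < e" if m: "m \<ge> N" for m n
      proof (cases "m \<le> n")
        case True
        have "(\<Sum>i\<in>{N..<n}. X i \<omega>) = (\<Sum>i\<in>{N..<m}. X i \<omega>) + (\<Sum>i\<in>{m..<n}. X i \<omega>)"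
          using m True by (simp add: sum.atLeastLessThan_concat)
        then show ?thesis
          using N[of m] N[of n] m True j by simp
      qed (use \<open>e > 0\<close> in simp)
      then show "\<exists>N. \<forall>m\<ge>N. \<forall>n. norm (\<Sum>i\<in>{m..<n}. X i \<omega>) < e" by blast
    qed
  qed
qed

end

section \<open>Exponential tilting of Gaussian variables\<close>

text \<open>A case of Vitali's theorem: bounded second moments give uniform integrability, and
  Fatou's lemma carries the bound over to h. It stands in for dominated convergence, since the
  pointwise bound on the truncated likelihoods, a product of factors exp(\<kappa> y_k^2 / 2), may
  grow without limit as factors are added.\<close>

lemma (in prob_space)
  fixes g :: "nat \<Rightarrow> 'a \<Rightarrow> 'b :: {banach, second_countable_topology}"
  assumes meas [measurable]: "\<And>n. g n \<in> borel_measurable M" "h \<in> borel_measurable M"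
    and lim: "AE \<omega> in M. (\<lambda>n. g n \<omega>) \<longlonglongrightarrow> h \<omega>"
    and sq: "\<And>n. integrable M (\<lambda>\<omega>. (norm (g n \<omega>))\<^sup>2)"
    and bound: "\<And>n. expectation (\<lambda>\<omega>. (norm (g n \<omega>))\<^sup>2) \<le> C"
  shows integrable_limit_L2_bounded: "integrable M h"
    and tendsto_integral_L2_bounded: "(\<lambda>n. integral\<^sup>L M (g n)) \<longlonglongrightarrow> integral\<^sup>L M h"
proof -
  have "0 \<le> expectation (\<lambda>\<omega>. (norm (g 0 \<omega>))\<^sup>2)" by simp
  also note bound[of 0]
  finally have C: "C \<ge> 0" .
  have nn: "(\<integral>\<^sup>+\<omega>. ennreal ((norm (g n \<omega>))\<^sup>2) \<partial>M) \<le> ennreal C" for n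
    using bound by (subst nn_integral_eq_integral[OF sq]) (auto intro: ennreal_leI)
  have "(\<integral>\<^sup>+\<omega>. ennreal ((norm (h \<omega>))\<^sup>2) \<partial>M)
      = (\<integral>\<^sup>+\<omega>. liminf (\<lambda>n. ennreal ((norm (g n \<omega>))\<^sup>2)) \<partial>M)"
    using lim
    by (intro nn_integral_cong_AE, eventually_elim)
      (auto intro!: lim_imp_Liminf[symmetric] tendsto_intros)
  also have "\<dots> \<le> liminf (\<lambda>n. \<integral>\<^sup>+\<omega>. ennreal ((norm (g n \<omega>))\<^sup>2) \<partial>M)"
    by (intro nn_integral_liminf) simp
  also have "\<dots> \<le> liminf (\<lambda>n. ennreal C)"
    using nn by (intro Liminf_mono) auto
  also have "\<dots> = ennreal C" by (simp add: Liminf_const)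
  finally have h_nn: "(\<integral>\<^sup>+\<omega>. ennreal ((norm (h \<omega>))\<^sup>2) \<partial>M) \<le> ennreal C" .
  then have h_sq: "integrable M (\<lambda>\<omega>. (norm (h \<omega>))\<^sup>2)"
    by (intro integrableI_bounded) (auto intro: le_less_trans)
  have h_bound: "expectation (\<lambda>\<omega>. (norm (h \<omega>))\<^sup>2) \<le> C"
    using h_nn C by (subst (asm) nn_integral_eq_integral[OF h_sq]) auto
  have g_int: "integrable M (g n)" for n
    by (rule integrable_norm_cancel, rule square_integrable_imp_integrable) (simp_all add: sq)
  show h_int: "integrable M h"
    by (rule integrable_norm_cancel, rule square_integrable_imp_integrable) (simp_all add: h_sq)
  define d where "d n \<omega> = norm (g n \<omega> - h \<omega>)" for n \<omega>
  have [measurable]: "d n \<in> borel_measurable M" for n unfolding d_def by measurable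
  have d_int: "integrable M (d n)" for n
    unfolding d_def using g_int h_int by simp
  have d_sq_le: "(d n \<omega>)\<^sup>2 \<le> 2 * (norm (g n \<omega>))\<^sup>2 + 2 * (norm (h \<omega>))\<^sup>2" for n \<omega>
  proof -
    have "(d n \<omega>)\<^sup>2 \<le> (norm (g n \<omega>) + norm (h \<omega>))\<^sup>2"
      unfolding d_def by (intro power_mono norm_triangle_ineq4) simp
    also have "\<dots> \<le> 2 * (norm (g n \<omega>))\<^sup>2 + 2 * (norm (h \<omega>))\<^sup>2"
      using sum_squares_bound[of "norm (g n \<omega>)" "norm (h \<omega>)"] by (simp add: power2_sum)
    finally show ?thesis .
  qed
  have d_sq: "integrable M (\<lambda>\<omega>. (d n \<omega>)\<^sup>2)" for n
  proof (rule Bochner_Integration.integrable_bound)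
    show "integrable M (\<lambda>\<omega>. 2 * (norm (g n \<omega>))\<^sup>2 + 2 * (norm (h \<omega>))\<^sup>2)"
      using sq h_sq by simp
    show "AE \<omega> in M. norm ((d n \<omega>)\<^sup>2) \<le> norm (2 * (norm (g n \<omega>))\<^sup>2 + 2 * (norm (h \<omega>))\<^sup>2)"
      using d_sq_le[of n] by (intro AE_I2) simp
  qed simp
  have d_bound: "expectation (\<lambda>\<omega>. (d n \<omega>)\<^sup>2) \<le> 4 * C" for n
  proof -
    have "expectation (\<lambda>\<omega>. (d n \<omega>)\<^sup>2)
        \<le> expectation (\<lambda>\<omega>. 2 * (norm (g n \<omega>))\<^sup>2 + 2 * (norm (h \<omega>))\<^sup>2)"
      using sq h_sq by (intro integral_mono d_sq d_sq_le) auto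
    then show ?thesis using bound[of n] h_bound sq h_sq by simp
  qed
  have "(\<lambda>n. expectation (d n)) \<longlonglongrightarrow> 0"
  proof (rule LIMSEQ_I)
    fix e :: real assume e: "e > 0"
    \<comment> \<open>Chosen so that 4 C / K \<le> e / 2; the added 1 keeps K positive when C =
      0.\<close>
    define K where "K = 8 * (C + 1) / e"
    have K: "K > 0" using e C by (simp add: K_def)
    have trunc: "expectation (d n) \<le> expectation (\<lambda>\<omega>. min (d n \<omega>) K) + 4 * C / K" for n
    proof -
      have min_int: "integrable M (\<lambda>\<omega>. min (d n \<omega>) K)"
        by (rule integrable_const_bound[of _ K]) (use K in \<open>auto simp: d_def\<close>)
      \<comment> \<open>The truncated part will converge by bounded convergence, while the excess
        over K is paid for by the second moment divided by K.\<close>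
      have "x \<le> min x K + x\<^sup>2 / K" if "x \<ge> 0" for x
      proof (cases "x \<le> K")
        case False
        then have "x * K \<le> x\<^sup>2"
          using that unfolding power2_eq_square by (intro mult_left_mono) auto
        then have "x \<le> x\<^sup>2 / K" using K by (simp add: field_simps)
        then show ?thesis using False K by simp
      qed (use K in auto)
      then have "expectation (d n) \<le> expectation (\<lambda>\<omega>. min (d n \<omega>) K + (d n \<omega>)\<^sup>2 / K)"
        using d_int d_sq min_int by (intro integral_mono) (auto simp: d_def)
      also have "\<dots> = expectation (\<lambda>\<omega>. min (d n \<omega>) K) + expectation (\<lambda>\<omega>. (d n \<omega>)\<^sup>2) / K"
        using d_sq min_int by simp
      also have "expectation (\<lambda>\<omega>. (d n \<omega>)\<^sup>2) / K \<le> 4 * C / K"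
        using d_bound K by (intro divide_right_mono) auto
      finally show ?thesis by simp
    qed
    have "(\<lambda>n. expectation (\<lambda>\<omega>. min (d n \<omega>) K)) \<longlonglongrightarrow> expectation (\<lambda>\<omega>. 0)"
    proof (rule integral_dominated_convergence[where w="\<lambda>_. K"])
      show "AE \<omega> in M. (\<lambda>n. min (d n \<omega>) K) \<longlonglongrightarrow> 0"
        using lim
      proof eventually_elim
        case (elim \<omega>)
        have "(\<lambda>n. min (d n \<omega>) K) \<longlonglongrightarrow> min (norm (h \<omega> - h \<omega>)) K"
          unfolding d_def by (intro tendsto_intros elim)
        then show ?case using K by simp
      qed
    qed (use K in \<open>auto simp: d_def\<close>)
    then have "eventually (\<lambda>n. expectation (\<lambda>\<omega>. min (d n \<omega>) K) < e / 2) sequentially"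
      using e by (intro order_tendstoD) auto
    then obtain n0 where n0: "\<And>n. n \<ge> n0 \<Longrightarrow> expectation (\<lambda>\<omega>. min (d n \<omega>) K) < e / 2"
      by (auto simp: eventually_sequentially)
    have "4 * C / K \<le> e / 2"
      using e C by (simp add: K_def field_simps)
    then have "norm (expectation (d n) - 0) < e" if "n \<ge> n0" for n
    proof -
      have "expectation (d n) \<ge> 0" by (simp add: d_def)
      then show ?thesis using n0[OF that] trunc[of n] \<open>4 * C / K \<le> e / 2\<close> by simp
    qed
    then show "\<exists>n0. \<forall>n\<ge>n0. norm (expectation (d n) - 0) < e" by blast
  qed
  then have "(\<lambda>n. integral\<^sup>L M (g n) - integral\<^sup>L M h) \<longlonglongrightarrow> 0"
  proof (rule Lim_null_comparison[rotated], intro always_eventually allI)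
    show "norm (integral\<^sup>L M (g n) - integral\<^sup>L M h) \<le> expectation (d n)" for n
      using integral_norm_bound[of M "\<lambda>\<omega>. g n \<omega> - h \<omega>"] g_int h_int by (simp add: d_def[abs_def])
  qed
  then show "(\<lambda>n. integral\<^sup>L M (g n)) \<longlonglongrightarrow> integral\<^sup>L M h"
    by (simp add: LIM_zero_iff)
qed

section \<open>Normal laws and a quadratic tilt of one coordinate\<close>

abbreviation normal_distribution :: "real \<Rightarrow> real \<Rightarrow> real measure" where
  "normal_distribution m \<sigma> \<equiv> density lborel (normal_density m \<sigma>)"

lemma real_distribution_normal: "\<sigma> > 0 \<Longrightarrow> real_distribution (normal_distribution m \<sigma>)"
  using prob_space_normal_density[of \<sigma> m]
  by (auto simp: real_distribution_def real_distribution_axioms_def)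

lemma normal_distribution_affine:
  assumes "\<sigma> > 0"
  shows "normal_distribution m \<sigma> = distr std_normal_distribution borel (\<lambda>x. m + \<sigma> * x)"
proof -
  interpret prob_space std_normal_distribution by (rule prob_space_normal_density) simp
  have "distributed std_normal_distribution lborel (\<lambda>x. x) (normal_density 0 1)"
    by (auto simp: distributed_def distr_id2 )
  from normal_density_affine[OF this, of \<sigma> m] assms
  have "distributed std_normal_distribution lborel (\<lambda>x. m + \<sigma> * x) (normal_density m \<sigma>)"
    by simp
  from distributed_distr_eq_density[OF this] show ?thesis
    by (simp cong: distr_cong)
qed

lemma char_normal_distribution:
  assumes "\<sigma> > 0"
  shows "char (normal_distribution m \<sigma>) t = iexp (t * m) * complex_of_real (exp (- (t\<^sup>2 * \<sigma>\<^sup>2 / 2)))"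
proof -
  have "char (normal_distribution m \<sigma>) t
      = (CLINT x|std_normal_distribution. iexp (t * (m + \<sigma> * x)))"
    unfolding char_def normal_distribution_affine[OF assms] by (subst integral_distr) auto
  also have "\<dots> = (CLINT x|std_normal_distribution. iexp (t * m) * iexp ((t * \<sigma>) * x))"
    by (simp add: exp_add[symmetric] algebra_simps)
  also have "\<dots> = iexp (t * m) * char std_normal_distribution (t * \<sigma>)"
    unfolding char_def by (rule integral_mult_right_zero)
  finally show ?thesis
    by (simp add: char_std_normal_distribution power_mult_distrib)
qed

text \<open>One coordinate of the fractional likelihood: \<kappa> is n \<alpha>, x the coefficient
  and y its observation.\<close>

definition tilt :: "real \<Rightarrow> real \<Rightarrow> real \<Rightarrow> real" where
  "tilt \<kappa> y x = exp (\<kappa> * (x * y) - \<kappa> / 2 * x\<^sup>2)"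

text \<open>The integral of \<open>tilt\<close> against N(0, l), as completing the square gives it;
  l / (1 + \<kappa> l) is the posterior variance of the coordinate.\<close>

definition tilt_mass :: "real \<Rightarrow> real \<Rightarrow> real \<Rightarrow> real" where
  "tilt_mass \<kappa> l y = exp (\<kappa>\<^sup>2 * y\<^sup>2 * (l / (1 + \<kappa> * l)) / 2) / sqrt (1 + \<kappa> * l)"

lemma tilt_measurable [measurable]: "tilt \<kappa> y \<in> borel_measurable borel"
  unfolding tilt_def by measurable

lemma tilt_pos: "tilt \<kappa> y x > 0" by (simp add: tilt_def)

lemma tilt_bounded: "\<kappa> \<ge> 0 \<Longrightarrow> tilt \<kappa> y x \<le> exp (\<kappa> * y\<^sup>2 / 2)"
proof -
  assume "\<kappa> \<ge> 0"
  then have "0 \<le> \<kappa> / 2 * (x - y)\<^sup>2" by simp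
  then show ?thesis by (simp add: tilt_def power2_diff algebra_simps)
qed

lemma tilt_mass_pos: "\<kappa> \<ge> 0 \<Longrightarrow> l > 0 \<Longrightarrow> tilt_mass \<kappa> l y > 0"
  by (simp add: tilt_mass_def add_pos_nonneg)

text \<open>Dropping both denominators leaves a bound whose product over all coordinates is the
  exponential of a multiple of the series of l_k y_k^2, which is the only summability that an
  observation offers.\<close>

lemma tilt_mass_le:
  assumes "\<kappa> \<ge> 0" "l > 0"
  shows "tilt_mass \<kappa> l y \<le> exp (\<kappa>\<^sup>2 / 2 * (l * y\<^sup>2))"
proof -
  define r where "r = l / (1 + \<kappa> * l)"
  have "r \<le> l"
    using assms by (simp add: r_def divide_le_eq mult_le_cancel_left1 add_pos_nonneg)
  then have "\<kappa>\<^sup>2 * y\<^sup>2 * r \<le> \<kappa>\<^sup>2 * y\<^sup>2 * l"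
    by (intro mult_left_mono) auto
  then have "exp (\<kappa>\<^sup>2 * y\<^sup>2 * r / 2) \<le> exp (\<kappa>\<^sup>2 * y\<^sup>2 * l / 2)"
    by simp
  moreover have "tilt_mass \<kappa> l y \<le> exp (\<kappa>\<^sup>2 * y\<^sup>2 * r / 2)"
    using assms by (simp add: tilt_mass_def r_def[symmetric] divide_le_eq mult_le_cancel_left1)
  moreover have "\<kappa>\<^sup>2 / 2 * (l * y\<^sup>2) = \<kappa>\<^sup>2 * y\<^sup>2 * l / 2" by simp
  ultimately show ?thesis by (metis order_trans)
qed

text \<open>Conjugacy in one coordinate: precisions add, 1/s = 1/l + \<kappa>, and completing the
  square produces both the mean \<kappa> y s and the mass.\<close>

lemma normal_density_times_tilt:
  assumes \<kappa>: "\<kappa> \<ge> 0" and l: "l > 0"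
  defines "s \<equiv> l / (1 + \<kappa> * l)"
  shows "normal_density 0 (sqrt l) x * tilt \<kappa> y x
    = tilt_mass \<kappa> l y * normal_density (\<kappa> * y * s) (sqrt s) x"
proof -
  have p: "1 + \<kappa> * l > 0" using assms by (simp add: add_pos_nonneg)
  have s: "s > 0" using p l by (simp add: s_def)
  have inv: "1 / s = 1 / l + \<kappa>" using p l by (simp add: s_def field_simps)
  have "- (x\<^sup>2 / (2 * l)) + (\<kappa> * (x * y) - \<kappa> / 2 * x\<^sup>2) = - (x\<^sup>2 / 2) * (1 / l + \<kappa>) + \<kappa> * x * y"
    by (simp add: algebra_simps)
  also have "\<dots> = \<kappa>\<^sup>2 * y\<^sup>2 * s / 2 + - ((x - \<kappa> * y * s)\<^sup>2 / (2 * s))"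
    unfolding inv[symmetric] using s by (simp add: power2_eq_square field_simps)
  finally have e: "exp (- (x\<^sup>2 / (2 * l))) * tilt \<kappa> y x
      = exp (\<kappa>\<^sup>2 * y\<^sup>2 * s / 2) * exp (- ((x - \<kappa> * y * s)\<^sup>2 / (2 * s)))"
    unfolding tilt_def exp_add[symmetric] by simp
  have "sqrt (2 * pi * l) = sqrt (1 + \<kappa> * l) * sqrt (2 * pi * s)"
    using p l by (simp add: s_def real_sqrt_mult[symmetric])
  then have "1 / sqrt (2 * pi * l) = 1 / sqrt (1 + \<kappa> * l) * (1 / sqrt (2 * pi * s))"
    by simp
  then show ?thesis
    using e l s by (simp add: normal_density_def tilt_mass_def s_def[symmetric])
qed

lemma (in prob_space) expectation_tilt_iexp:
  fixes X :: "'a \<Rightarrow> real"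
  assumes X: "distributed M lborel X (normal_density 0 (sqrt l))"
    and \<kappa>: "\<kappa> \<ge> 0" and l: "l > 0"
  defines "s \<equiv> l / (1 + \<kappa> * l)"
  shows "(CLINT \<omega>|M. tilt \<kappa> y (X \<omega>) * iexp (u * X \<omega>))
    = tilt_mass \<kappa> l y * (iexp (u * (\<kappa> * y * s)) * complex_of_real (exp (- (u\<^sup>2 * s / 2))))"
proof -
  have s: "s > 0" using assms by (simp add: s_def add_pos_nonneg)
  have rv: "X \<in> measurable M lborel" using X by (simp add: distributed_def)
  have "(CLINT \<omega>|M. tilt \<kappa> y (X \<omega>) * iexp (u * X \<omega>))
      = (CLINT x|distr M lborel X. tilt \<kappa> y x * iexp (u * x))"
    using rv by (subst integral_distr) auto
  also have "\<dots> = (CLINT x|lborel. normal_density 0 (sqrt l) x *\<^sub>R (tilt \<kappa> y x * iexp (u * x)))"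
    unfolding distributed_distr_eq_density[OF X] by (subst integral_density) auto
  also have "\<dots> = (CLINT x|lborel. tilt_mass \<kappa> l y *
      (normal_density (\<kappa> * y * s) (sqrt s) x *\<^sub>R iexp (u * x)))"
  proof -
    have "normal_density 0 (sqrt l) x *\<^sub>R (tilt \<kappa> y x * z)
        = tilt_mass \<kappa> l y * (normal_density (\<kappa> * y * s) (sqrt s) x *\<^sub>R z)" for x and z :: complex
    proof -
      have "normal_density 0 (sqrt l) x *\<^sub>R (tilt \<kappa> y x * z)
          = complex_of_real (normal_density 0 (sqrt l) x * tilt \<kappa> y x) * z"
        by (simp add: scaleR_conv_of_real)
      also have "\<dots> = complex_of_real (tilt_mass \<kappa> l y * normal_density (\<kappa> * y * s) (sqrt s) x) * z"
        unfolding s_def by (subst normal_density_times_tilt[OF \<kappa> l]) (rule refl)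
      finally show ?thesis by (simp add: scaleR_conv_of_real)
    qed
    then show ?thesis by (intro Bochner_Integration.integral_cong) simp_all
  qed
  also have "\<dots> = tilt_mass \<kappa> l y *
      (CLINT x|lborel. normal_density (\<kappa> * y * s) (sqrt s) x *\<^sub>R iexp (u * x))"
    by (rule integral_mult_right_zero)
  also have "(CLINT x|lborel. normal_density (\<kappa> * y * s) (sqrt s) x *\<^sub>R iexp (u * x))
      = char (normal_distribution (\<kappa> * y * s) (sqrt s)) u"
    unfolding char_def by (subst integral_density) auto
  also have "\<dots> = iexp (u * (\<kappa> * y * s)) * complex_of_real (exp (- (u\<^sup>2 * s / 2)))"
    using s by (subst char_normal_distribution) auto
  finally show ?thesis .
qed

lemma (in prob_space) expectation_tilt:
  fixes X :: "'a \<Rightarrow> real"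
  assumes X: "distributed M lborel X (normal_density 0 (sqrt l))"
    and \<kappa>: "\<kappa> \<ge> 0" and l: "l > 0"
  shows "expectation (\<lambda>\<omega>. tilt \<kappa> y (X \<omega>)) = tilt_mass \<kappa> l y"
proof -
  have "complex_of_real (expectation (\<lambda>\<omega>. tilt \<kappa> y (X \<omega>)))
      = (CLINT \<omega>|M. tilt \<kappa> y (X \<omega>) * iexp (0 * X \<omega>))" by simp
  also have "\<dots> = complex_of_real (tilt_mass \<kappa> l y)"
    by (subst expectation_tilt_iexp[OF assms]) simp
  finally show ?thesis by (simp only: of_real_eq_iff)
qed

text \<open>Second moments of products of tilts are therefore again masses, at 2 \<kappa>; the
  uniform L2 bound on truncated likelihoods rests on this.\<close>

lemma tilt_square: "(tilt \<kappa> y x)\<^sup>2 = tilt (2 * \<kappa>) y x"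
  by (simp add: tilt_def exp_double[symmetric] algebra_simps)

section \<open>Gaussian sequences under an infinite product of tilts\<close>

locale gaussian_sequence = prob_space +
  fixes X :: "nat \<Rightarrow> 'a \<Rightarrow> real" and lam :: "nat \<Rightarrow> real"
  assumes indep: "indep_vars (\<lambda>_. borel) X UNIV"
    and normal: "\<And>k. distributed M lborel (X k) (normal_density 0 (sqrt (lam k)))"
    and lam_pos: "\<And>k. lam k > 0"
begin

lemma rv [measurable]: "random_variable borel (X k)"
  using indep by (auto simp: indep_vars_def)

lemma expectation_X: "expectation (X k) = 0"
  using normal_distributed_expectation[OF _ normal] lam_pos by simp

lemma expectation_X_square: "expectation (\<lambda>\<omega>. (X k \<omega>)\<^sup>2) = lam k"
  using normal_distributed_variance[OF _ normal] lam_pos[of k] by (simp add: expectation_X)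

lemma integrable_X_square: "integrable M (\<lambda>\<omega>. (X k \<omega>)\<^sup>2)"
  using expectation_X_square[of k] lam_pos[of k] not_integrable_integral_eq by fastforce

text \<open>The k-th term has variance \<open>lam k * (c k)\<^sup>2\<close>, so the one-series
  theorem applies. An observation will take the place of c, and only this weighted summability is
  asked of it.\<close>

lemma AE_summable_X_mult:
  assumes "summable (\<lambda>k. lam k * (c k)\<^sup>2)"
  shows "AE \<omega> in M. summable (\<lambda>k. X k \<omega> * c k)"
proof (rule AE_summable_indep)
  show "indep_vars (\<lambda>_. borel) (\<lambda>k \<omega>. X k \<omega> * c k) UNIV"
    by (rule indep_vars_compose2[OF indep]) measurable
  have sq: "(\<lambda>\<omega>. (X k \<omega> * c k)\<^sup>2) = (\<lambda>\<omega>. (X k \<omega>)\<^sup>2 * (c k)\<^sup>2)" for k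
    by (simp add: power_mult_distrib)
  show "integrable M (\<lambda>\<omega>. (X k \<omega> * c k)\<^sup>2)" for k
    unfolding sq using integrable_X_square by simp
  show "expectation (\<lambda>\<omega>. X k \<omega> * c k) = 0" for k
    using expectation_X by simp
  show "summable (\<lambda>k. expectation (\<lambda>\<omega>. (X k \<omega> * c k)\<^sup>2))"
    unfolding sq using assms expectation_X_square by simp
qed

context
  fixes \<kappa> :: real and y a :: "nat \<Rightarrow> real"
  assumes \<kappa>: "\<kappa> \<ge> 0"
    and y: "summable (\<lambda>k. lam k * (y k)\<^sup>2)"
    and a: "summable (\<lambda>k. lam k * (a k)\<^sup>2)"
    and X2: "AE \<omega> in M. summable (\<lambda>k. (X k \<omega>)\<^sup>2)"
begin

definition tilt_density :: "'a \<Rightarrow> real" where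
  "tilt_density \<omega> = exp (\<kappa> * (\<Sum>k. X k \<omega> * y k) - \<kappa> / 2 * (\<Sum>k. (X k \<omega>)\<^sup>2))"

text \<open>The oscillating factors are carried along with the likelihood so that a single limit
  yields the normalising constant, at u = 0, as well as the characteristic function of the
  functional.\<close>

definition truncation :: "real \<Rightarrow> nat \<Rightarrow> 'a \<Rightarrow> complex" where
  "truncation u N \<omega> = (\<Prod>k<N. tilt \<kappa> (y k) (X k \<omega>) * iexp (u * a k * X k \<omega>))"

lemma tilt_density_measurable [measurable]: "tilt_density \<in> borel_measurable M"
  unfolding tilt_density_def by measurable

lemma truncation_measurable [measurable]: "truncation u N \<in> borel_measurable M"
  unfolding truncation_def by measurable

text \<open>The exponent of the product consists of partial sums of three series, and each of them
  converges almost surely.\<close>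

lemma truncation_tendsto:
  "AE \<omega> in M. (\<lambda>N. truncation u N \<omega>) \<longlonglongrightarrow> tilt_density \<omega> * iexp (u * (\<Sum>k. X k \<omega> * a k))"
  using X2 AE_summable_X_mult[OF y] AE_summable_X_mult[OF a]
proof eventually_elim
  case (elim \<omega>)
  have eq: "truncation u N \<omega>
      = complex_of_real (exp (\<kappa> * (\<Sum>k<N. X k \<omega> * y k) - \<kappa> / 2 * (\<Sum>k<N. (X k \<omega>)\<^sup>2)))
        * iexp (u * (\<Sum>k<N. X k \<omega> * a k))" for N
  proof (induction N)
    case (Suc N)
    then show ?case
      by (simp add: truncation_def tilt_def exp_of_real[symmetric] exp_add[symmetric] algebra_simps)
  qed (simp add: truncation_def)
  show ?case
    unfolding eq tilt_density_def
    by (intro tendsto_intros summable_LIMSEQ elim)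
qed

lemma norm_truncation_square:
  "(norm (truncation u N \<omega>))\<^sup>2 = (\<Prod>k<N. tilt (2 * \<kappa>) (y k) (X k \<omega>))"
  by (simp add: truncation_def prod_norm[symmetric] norm_mult prod_power_distrib
      tilt_square tilt_pos less_imp_le)

lemma integrable_tilt: "c \<ge> 0 \<Longrightarrow> integrable M (\<lambda>\<omega>. tilt c z (X k \<omega>))"
  by (rule integrable_const_bound[of _ "exp (c * z\<^sup>2 / 2)"])
    (auto simp: tilt_bounded tilt_pos less_imp_le)

text \<open>The oscillating factors have modulus 1, and each mass at 2 \<kappa> is at most exp((2
  \<kappa>)^2 / 2 * lam_k y_k^2); this is where the constant 2 \<kappa>^2 comes from.\<close>

lemma
  shows integrable_truncation_square: "integrable M (\<lambda>\<omega>. (norm (truncation u N \<omega>))\<^sup>2)"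
    and expectation_truncation_square:
      "expectation (\<lambda>\<omega>. (norm (truncation u N \<omega>))\<^sup>2) \<le> exp (2 * \<kappa>\<^sup>2 * (\<Sum>k. lam k * (y k)\<^sup>2))"
proof -
  have ind: "indep_vars (\<lambda>_. borel) (\<lambda>k \<omega>. tilt (2 * \<kappa>) (y k) (X k \<omega>)) {..<N}"
    by (rule indep_vars_compose2[OF indep_vars_subset[OF indep]]) auto
  have int: "integrable M (\<lambda>\<omega>. tilt (2 * \<kappa>) (y k) (X k \<omega>))" for k
    using \<kappa> by (intro integrable_tilt) simp
  show "integrable M (\<lambda>\<omega>. (norm (truncation u N \<omega>))\<^sup>2)"
    unfolding norm_truncation_square by (intro indep_vars_integrable ind int) simp
  have "expectation (\<lambda>\<omega>. (norm (truncation u N \<omega>))\<^sup>2) = (\<Prod>k<N. tilt_mass (2 * \<kappa>) (lam k) (y k))"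
    unfolding norm_truncation_square using \<kappa>
    by (subst indep_vars_lebesgue_integral[OF _ ind int])
      (auto intro!: prod.cong expectation_tilt normal lam_pos)
  also have "\<dots> \<le> (\<Prod>k<N. exp ((2 * \<kappa>)\<^sup>2 / 2 * (lam k * (y k)\<^sup>2)))"
    using \<kappa> by (intro prod_mono conjI tilt_mass_le lam_pos less_imp_le[OF tilt_mass_pos]) auto
  also have "\<dots> = exp (2 * \<kappa>\<^sup>2 * (\<Sum>k<N. lam k * (y k)\<^sup>2))"
    by (simp add: exp_sum[symmetric] sum_distrib_left power_mult_distrib)
  also have "\<dots> \<le> exp (2 * \<kappa>\<^sup>2 * (\<Sum>k. lam k * (y k)\<^sup>2))"
  proof -
    have "0 \<le> lam k * (y k)\<^sup>2" for k using lam_pos[of k] by simp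
    then show ?thesis by (auto intro!: mult_left_mono sum_le_suminf y)
  qed
  finally show "expectation (\<lambda>\<omega>. (norm (truncation u N \<omega>))\<^sup>2)
      \<le> exp (2 * \<kappa>\<^sup>2 * (\<Sum>k. lam k * (y k)\<^sup>2))" .
qed

lemma
  shows integrable_tilt_density_iexp:
      "integrable M (\<lambda>\<omega>. tilt_density \<omega> * iexp (u * (\<Sum>k. X k \<omega> * a k)))"
    and truncation_integral_tendsto:
      "(\<lambda>N. CLINT \<omega>|M. truncation u N \<omega>)
        \<longlonglongrightarrow> (CLINT \<omega>|M. tilt_density \<omega> * iexp (u * (\<Sum>k. X k \<omega> * a k)))"
  by (rule integrable_limit_L2_bounded[OF _ _ truncation_tendsto
        integrable_truncation_square expectation_truncation_square]; measurable)
    (rule tendsto_integral_L2_bounded[OF _ _ truncation_tendsto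
        integrable_truncation_square expectation_truncation_square]; measurable)

lemma integrable_tilt_density: "integrable M tilt_density"
  using integrable_tilt_density_iexp[of 0] by (simp add: complex_of_real_integrable_eq)

lemma expectation_tilt_density_pos: "expectation tilt_density > 0"
proof -
  have "expectation tilt_density \<noteq> 0"
    by (subst integral_nonneg_eq_0_iff_AE[OF integrable_tilt_density])
      (auto simp: tilt_density_def AE_False)
  moreover have "expectation tilt_density \<ge> 0"
    by (simp add: tilt_density_def)
  ultimately show ?thesis by simp
qed

definition tilted_var :: "nat \<Rightarrow> real" where
  "tilted_var k = lam k / (1 + \<kappa> * lam k)"

lemma one_plus_pos: "1 + \<kappa> * lam k > 0"
  using \<kappa> lam_pos[of k] by (simp add: add_pos_nonneg)

lemma tilted_var_pos: "tilted_var k > 0"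
  using one_plus_pos lam_pos by (simp add: tilted_var_def)

lemma tilted_var_le: "tilted_var k \<le> lam k"
  using one_plus_pos[of k] lam_pos[of k] \<kappa>
  by (simp add: tilted_var_def divide_le_eq mult_le_cancel_left1)

lemma summable_tilted_var: "summable (\<lambda>k. tilted_var k * (a k)\<^sup>2)"
  by (rule summable_comparison_test'[OF a, of 0])
    (auto simp: tilted_var_le abs_mult abs_of_pos[OF tilted_var_pos] mult_right_mono)

lemma summable_tilted_mean: "summable (\<lambda>k. a k * (\<kappa> * y k * tilted_var k))"
proof (rule summable_comparison_test')
  show "summable (\<lambda>k. \<kappa> * (lam k * (a k)\<^sup>2 + lam k * (y k)\<^sup>2))"
    by (intro summable_mult summable_add a y)
  fix k
  have "\<bar>a k\<bar> * \<bar>y k\<bar> \<le> (a k)\<^sup>2 + (y k)\<^sup>2"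
    using sum_squares_bound[of "\<bar>a k\<bar>" "\<bar>y k\<bar>"] mult_nonneg_nonneg[of "\<bar>a k\<bar>" "\<bar>y k\<bar>"]
    unfolding power2_abs by linarith
  then have "tilted_var k * (\<bar>a k\<bar> * \<bar>y k\<bar>) \<le> lam k * ((a k)\<^sup>2 + (y k)\<^sup>2)"
    using tilted_var_le[of k] lam_pos[of k] by (intro mult_mono) auto
  then have "\<kappa> * (tilted_var k * (\<bar>a k\<bar> * \<bar>y k\<bar>)) \<le> \<kappa> * (lam k * ((a k)\<^sup>2 + (y k)\<^sup>2))"
    using \<kappa> by (rule mult_left_mono)
  then show "norm (a k * (\<kappa> * y k * tilted_var k)) \<le> \<kappa> * (lam k * (a k)\<^sup>2 + lam k * (y k)\<^sup>2)"
    using \<kappa> tilted_var_pos[of k] by (simp add: abs_mult abs_of_pos algebra_simps)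
qed

lemma expectation_truncation:
  "(CLINT \<omega>|M. truncation u N \<omega>) = (\<Prod>k<N. tilt_mass \<kappa> (lam k) (y k))
    * (iexp (u * (\<Sum>k<N. a k * (\<kappa> * y k * tilted_var k)))
       * complex_of_real (exp (- (u\<^sup>2 * (\<Sum>k<N. tilted_var k * (a k)\<^sup>2) / 2))))"
proof -
  have ind: "indep_vars (\<lambda>_. borel) (\<lambda>k \<omega>. tilt \<kappa> (y k) (X k \<omega>) * iexp (u * a k * X k \<omega>)) {..<N}"
    by (rule indep_vars_compose2[OF indep_vars_subset[OF indep]]) auto
  have int: "integrable M (\<lambda>\<omega>. tilt \<kappa> (y k) (X k \<omega>) * iexp (u * a k * X k \<omega>))" for k
    by (rule integrable_const_bound[of _ "exp (\<kappa> * (y k)\<^sup>2 / 2)"])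
      (auto simp: norm_mult tilt_bounded[OF \<kappa>] tilt_pos less_imp_le)
  have "(CLINT \<omega>|M. truncation u N \<omega>) = (\<Prod>k<N. tilt_mass \<kappa> (lam k) (y k) *
     (iexp (u * a k * (\<kappa> * y k * tilted_var k))
      * complex_of_real (exp (- ((u * a k)\<^sup>2 * tilted_var k / 2)))))"
    unfolding truncation_def tilted_var_def
    by (subst indep_vars_lebesgue_integral[OF _ ind int], simp,
        rule prod.cong[OF refl expectation_tilt_iexp[OF normal \<kappa> lam_pos]])
  also have "\<dots> = (\<Prod>k<N. tilt_mass \<kappa> (lam k) (y k))
    * (iexp (u * (\<Sum>k<N. a k * (\<kappa> * y k * tilted_var k)))
       * complex_of_real (exp (- (u\<^sup>2 * (\<Sum>k<N. tilted_var k * (a k)\<^sup>2) / 2))))"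
  proof (induction N)
    case (Suc N)
    have "iexp (u * (\<Sum>k<Suc N. a k * (\<kappa> * y k * tilted_var k)))
      = iexp (u * (\<Sum>k<N. a k * (\<kappa> * y k * tilted_var k))) * iexp (u * a N * (\<kappa> * y N * tilted_var N))"
      by (simp add: exp_add[symmetric] algebra_simps)
    moreover have "exp (- (u\<^sup>2 * (\<Sum>k<Suc N. tilted_var k * (a k)\<^sup>2) / 2))
      = exp (- (u\<^sup>2 * (\<Sum>k<N. tilted_var k * (a k)\<^sup>2) / 2)) * exp (- ((u * a N)\<^sup>2 * tilted_var N / 2))"
      by (simp add: exp_add[symmetric] power_mult_distrib algebra_simps add_divide_distrib)
    ultimately show ?case
      using Suc by (simp only: prod.lessThan_Suc of_real_mult ac_simps)
  qed simp
  finally show ?thesis .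
qed

lemma expectation_tilt_density_iexp:
  "(CLINT \<omega>|M. tilt_density \<omega> * iexp (u * (\<Sum>k. X k \<omega> * a k)))
    = expectation tilt_density * (iexp (u * (\<Sum>k. a k * (\<kappa> * y k * tilted_var k)))
       * complex_of_real (exp (- (u\<^sup>2 * (\<Sum>k. tilted_var k * (a k)\<^sup>2) / 2))))"
proof (rule LIMSEQ_unique[OF truncation_integral_tendsto])
  \<comment> \<open>At u = 0 the truncated integrals reduce to the products of masses, so the limit
    of these products is identified without evaluating it.\<close>
  have "(\<lambda>N. complex_of_real (\<Prod>k<N. tilt_mass \<kappa> (lam k) (y k))) \<longlonglongrightarrow> complex_of_real (expectation tilt_density)"
    using truncation_integral_tendsto[of 0] unfolding expectation_truncation
    by (simp del: of_real_prod)
  then show "(\<lambda>N. CLINT \<omega>|M. truncation u N \<omega>) \<longlonglongrightarrow>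
      expectation tilt_density * (iexp (u * (\<Sum>k. a k * (\<kappa> * y k * tilted_var k)))
       * complex_of_real (exp (- (u\<^sup>2 * (\<Sum>k. tilted_var k * (a k)\<^sup>2) / 2))))"
    unfolding expectation_truncation
    by (rule tendsto_mult)
      (intro tendsto_intros summable_LIMSEQ summable_tilted_mean summable_tilted_var; simp)
qed

text \<open>Levy's uniqueness theorem, applied to the limit transform divided by its value at 0. The
  condition on \<open>a 0\<close> makes the variance positive, so that the right-hand side is a
  genuine normal law.\<close>

theorem distr_tilted_functional:
  assumes "a 0 \<noteq> 0"
  shows "distr (density M (\<lambda>\<omega>. ennreal (tilt_density \<omega> / expectation tilt_density))) borel
      (\<lambda>\<omega>. \<Sum>k. X k \<omega> * a k)
    = normal_distribution (\<Sum>k. a k * (\<kappa> * y k * tilted_var k)) (sqrt (\<Sum>k. tilted_var k * (a k)\<^sup>2))"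
    (is "distr ?Q borel ?T = ?N")
proof (rule Levy_uniqueness)
  let ?Z = "expectation tilt_density"
  have Z: "?Z > 0" by (rule expectation_tilt_density_pos)
  have "0 < tilted_var 0 * (a 0)\<^sup>2" using assms tilted_var_pos by simp
  then have v: "(\<Sum>k. tilted_var k * (a k)\<^sup>2) > 0"
    using less_imp_le[OF tilted_var_pos] by (intro suminf_pos2[OF summable_tilted_var]) auto
  show "real_distribution ?N" using v by (intro real_distribution_normal) simp
  have nonneg: "tilt_density \<omega> / ?Z \<ge> 0" for \<omega> using Z by (simp add: tilt_density_def)
  have "emeasure ?Q (space ?Q) = (\<integral>\<^sup>+\<omega>. ennreal (tilt_density \<omega> / ?Z) \<partial>M)"
    by (simp add: emeasure_density cong: nn_integral_cong)
  also have "\<dots> = 1"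
    using Z nonneg integrable_tilt_density by (subst nn_integral_eq_integral) auto
  finally interpret Q: prob_space ?Q by (intro prob_spaceI)
  have T: "?T \<in> borel_measurable ?Q" by simp
  then show "real_distribution (distr ?Q borel ?T)" by (rule Q.real_distribution_distr)
  show "char (distr ?Q borel ?T) = char ?N"
  proof
    fix u
    have "char (distr ?Q borel ?T) u = (CLINT \<omega>|?Q. iexp (u * ?T \<omega>))"
      unfolding char_def using T by (subst integral_distr) auto
    also have "\<dots> = (CLINT \<omega>|M. (tilt_density \<omega> / ?Z) *\<^sub>R iexp (u * ?T \<omega>))"
      using nonneg by (subst integral_density) auto
    also have "\<dots> = (CLINT \<omega>|M. tilt_density \<omega> * iexp (u * ?T \<omega>) / ?Z)"
      by (simp add: scaleR_conv_of_real)
    also have "\<dots> = (CLINT \<omega>|M. tilt_density \<omega> * iexp (u * ?T \<omega>)) / ?Z"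
      by (rule integral_divide_zero)
    also have "\<dots> = char ?N u"
      using Z v by (subst expectation_tilt_density_iexp, subst char_normal_distribution) simp_all
    finally show "char (distr ?Q borel ?T) u = char ?N u" .
  qed
qed

end

end

section \<open>The fractional posterior\<close>

lemma gaussian_series_prior_sequence:
  assumes "gaussian_series_prior \<phi> lam prior" "\<And>k. lam k > 0"
  shows "gaussian_sequence prior (\<lambda>k f. coef \<phi> f k) lam"
  using assms by (simp add: gaussian_series_prior_def gaussian_sequence_def gaussian_sequence_axioms_def)

locale white_noise_model =
  fixes \<phi> :: "nat \<Rightarrow> real \<Rightarrow> real" and lam :: "nat \<Rightarrow> real"
    and prior :: "(real \<Rightarrow> real) measure" and a :: "real \<Rightarrow> real"
  assumes basis: "orthonormal_basis_L2 \<phi>"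
    and prior: "gaussian_series_prior \<phi> lam prior"
    and lam_pos: "\<And>k. lam k > 0" and lam_summable: "summable lam"
    and a: "a \<in> L2" and coef_a_pos: "\<And>k. coef \<phi> a k > 0"
begin

sublocale prior: gaussian_sequence prior "\<lambda>k f. coef \<phi> f k" lam
  by (rule gaussian_series_prior_sequence[OF prior lam_pos])

lemma space_prior: "space prior = L2"
  using prior by (simp add: gaussian_series_prior_def)

lemma inner_L2_eq: "f \<in> L2 \<Longrightarrow> inner_L2 f f = (\<Sum>k. (coef \<phi> f k)\<^sup>2)"
  using coef_square_sums[OF basis] by (simp add: sums_iff)

lemma linear_functional_sums:
  assumes "f \<in> L2"
  shows "(\<lambda>k. coef \<phi> f k * coef \<phi> a k) sums linear_functional a f"
  using coef_mult_sums[OF basis assms a]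
  by (simp add: linear_functional_def inner_L2_def mult.commute)

text \<open>The sigma-algebra of the prior is only known to make the coefficients measurable, so the
  integral is rewritten as a series in them by Parseval's identity, valid on the whole space of the
  prior.\<close>

lemma inner_L2_measurable [measurable]: "(\<lambda>f. inner_L2 f f) \<in> borel_measurable prior"
proof (subst measurable_cong)
  show "f \<in> space prior \<Longrightarrow> inner_L2 f f = (\<Sum>k. (coef \<phi> f k)\<^sup>2)" for f
    by (simp add: space_prior inner_L2_eq)
qed measurable

lemma linear_functional_measurable [measurable]: "linear_functional a \<in> borel_measurable prior"
proof (subst measurable_cong)
  show "f \<in> space prior \<Longrightarrow> linear_functional a f = (\<Sum>k. coef \<phi> f k * coef \<phi> a k)" for f
    using linear_functional_sums[of f] by (simp add: space_prior sums_iff)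
qed measurable

lemma summable_coef_a_square: "summable (\<lambda>k. (coef \<phi> a k)\<^sup>2)"
  using coef_square_sums[OF basis a] by (simp add: sums_iff)

lemma lam_bounded: "\<exists>C>0. \<forall>k. lam k \<le> C"
proof -
  have "Bseq lam"
    using summable_LIMSEQ_zero[OF lam_summable] convergentI convergent_imp_Bseq by blast
  then obtain C where "C > 0" "\<forall>k. norm (lam k) \<le> C" by (rule BseqE)
  then show ?thesis using lam_pos by (auto simp: abs_of_pos)
qed

lemma summable_lam_mult:
  assumes "summable c" "\<And>k. c k \<ge> 0"
  shows "summable (\<lambda>k. lam k * c k)"
proof -
  obtain C where C: "C > 0" "\<forall>k. lam k \<le> C" using lam_bounded by blast
  show ?thesis
    using C assms lam_pos
    by (intro summable_comparison_test'[OF summable_mult[OF assms(1), of C], of 0])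
      (auto simp: abs_mult abs_of_pos intro!: mult_right_mono)
qed

lemma AE_summable_coef_square: "AE f in prior. summable (\<lambda>k. (coef \<phi> f k)\<^sup>2)"
  using coef_square_sums[OF basis] by (intro AE_I2) (auto simp: space_prior sums_iff)

text \<open>By Parseval's identity for its quadratic part, the fractional likelihood is
  \<open>tilt_density\<close> at \<kappa> = n \<alpha>. The observation is fixed here; its
  summability against \<open>lam\<close> replaces any statement about its law.\<close>

lemma functional_posterior_normal:
  fixes n :: nat
  assumes \<alpha>: "\<alpha> \<ge> 0" and Y: "summable (\<lambda>k. lam k * (Y k)\<^sup>2)"
  defines "s \<equiv> \<lambda>k. lam k / (1 + real n * \<alpha> * lam k)"
  shows "functional_posterior prior \<phi> a \<alpha> n Y = normal_distribution
    (\<Sum>k. coef \<phi> a k * (real n * \<alpha> * Y k * s k)) (sqrt (\<Sum>k. s k * (coef \<phi> a k)\<^sup>2))"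
proof -
  let ?\<kappa> = "real n * \<alpha>"
  have \<kappa>: "?\<kappa> \<ge> 0" using \<alpha> by simp
  have a2: "summable (\<lambda>k. lam k * (coef \<phi> a k)\<^sup>2)"
    using summable_coef_a_square by (rule summable_lam_mult) simp
  let ?D = "prior.tilt_density ?\<kappa> Y"
  note D_def = prior.tilt_density_def[OF \<kappa> Y a2 AE_summable_coef_square]
  note Z_pos = prior.expectation_tilt_density_pos[OF \<kappa> Y a2 AE_summable_coef_square]
  have D_meas: "?D \<in> borel_measurable prior"
    by (rule prior.tilt_density_measurable[OF \<kappa> Y a2 AE_summable_coef_square])
  \<comment> \<open>This holds at every f in the space of the prior, convergent or not: both sides
    contain the same \<open>suminf\<close> and share its default value where the series
    diverges.\<close>
  have D: "exp (\<alpha> * log_likelihood \<phi> n Y f) = ?D f" if "f \<in> space prior" for f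
    using that inner_L2_eq[of f] unfolding D_def log_likelihood_def
    by (simp add: space_prior algebra_simps)
  have "(\<integral>\<^sup>+g. ennreal (exp (\<alpha> * log_likelihood \<phi> n Y g)) \<partial>prior) = (\<integral>\<^sup>+g. ennreal (?D g) \<partial>prior)"
    by (intro nn_integral_cong) (simp add: D)
  also have "\<dots> = ennreal (prior.expectation ?D)"
    using prior.integrable_tilt_density[OF \<kappa> Y a2 AE_summable_coef_square]
    by (intro nn_integral_eq_integral AE_I2) (simp, simp add: D_def)
  finally have Z: "(\<integral>\<^sup>+g. ennreal (exp (\<alpha> * log_likelihood \<phi> n Y g)) \<partial>prior) = ennreal (prior.expectation ?D)" .
  have "frac_posterior prior \<phi> \<alpha> n Y = density prior (\<lambda>f. ennreal (?D f / prior.expectation ?D))"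
    unfolding frac_posterior_def Z
  proof (rule density_cong)
    show "(\<lambda>f. ennreal (exp (\<alpha> * log_likelihood \<phi> n Y f)) / ennreal (prior.expectation ?D))
        \<in> borel_measurable prior"
    proof (subst measurable_cong)
      show "f \<in> space prior \<Longrightarrow> ennreal (exp (\<alpha> * log_likelihood \<phi> n Y f)) / ennreal (prior.expectation ?D)
          = ennreal (?D f) / ennreal (prior.expectation ?D)" for f by (simp add: D)
    qed (use D_meas in measurable)
    show "AE f in prior. ennreal (exp (\<alpha> * log_likelihood \<phi> n Y f)) / ennreal (prior.expectation ?D)
          = ennreal (?D f / prior.expectation ?D)"
      using Z_pos by (intro AE_I2) (simp add: D divide_ennreal D_def)
  qed (use D_meas in measurable)
  then have "functional_posterior prior \<phi> a \<alpha> n Y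
      = distr (density prior (\<lambda>f. ennreal (?D f / prior.expectation ?D))) borel
          (\<lambda>f. \<Sum>k. coef \<phi> f k * coef \<phi> a k)"
    unfolding functional_posterior_def using linear_functional_sums
    by (auto intro!: distr_cong simp: space_prior sums_iff)
  also have "\<dots> = normal_distribution
    (\<Sum>k. coef \<phi> a k * (?\<kappa> * Y k * s k)) (sqrt (\<Sum>k. s k * (coef \<phi> a k)\<^sup>2))"
    using coef_a_pos[of 0] unfolding s_def
    by (subst prior.distr_tilted_functional[OF \<kappa> Y a2 AE_summable_coef_square])
      (simp_all add: prior.tilted_var_def[OF \<kappa> Y a2 AE_summable_coef_square])
  finally show ?thesis .
qed

end

section \<open>The normal distribution function\<close>

definition Phi :: "real \<Rightarrow> real" where
  "Phi = cdf std_normal_distribution"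

interpretation std_normal: real_distribution std_normal_distribution
  by (rule real_dist_normal_dist)

lemma Phi_diff:
  assumes "x \<le> y"
  shows "Phi y - Phi x = integral {x..y} std_normal_density"
proof (cases "x = y")
  case False
  then have xy: "x < y" using assms by simp
  have "Phi y - Phi x = measure std_normal_distribution {x<..y}"
    unfolding Phi_def using std_normal.cdf_diff_eq[OF xy] by simp
  also have "\<dots> = integral\<^sup>L std_normal_distribution (indicator {x<..y})"
    by simp
  also have "\<dots> = (LINT t:{x<..y}|lborel. std_normal_density t)"
    unfolding set_lebesgue_integral_def
    by (subst integral_density) (auto simp: mult.commute)
  also have "\<dots> = integral {x<..y} std_normal_density"
    by (intro set_borel_integral_eq_integral)
      (unfold set_integrable_def, intro integrable_mult_indicator, auto)
  also have "\<dots> = integral {x..y} std_normal_density"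
  proof (rule integral_subset_negligible)
    have "{x..y} - {x<..y} = {x}" using xy by auto
    then show "negligible ({x..y} - {x<..y})" by simp
  qed auto
  finally show ?thesis .
qed simp

lemma continuous_on_normal_density: "continuous_on S std_normal_density"
  unfolding normal_density_def by (intro continuous_intros) auto

lemma DERIV_Phi: "(Phi has_real_derivative std_normal_density x) (at x)"
proof -
  have "((\<lambda>y. integral {x - 1..y} std_normal_density) has_real_derivative std_normal_density x)
      (at x within {x - 1..x + 1})"
    by (intro integral_has_real_derivative continuous_on_normal_density) auto
  then have "((\<lambda>y. Phi (x - 1) + integral {x - 1..y} std_normal_density) has_real_derivative
      std_normal_density x) (at x within {x - 1..x + 1})"
    by (auto intro!: derivative_eq_intros)
  moreover have "at x within {x - 1..x + 1} = at x"
    by (intro at_within_interior) auto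
  ultimately have deriv: "((\<lambda>y. Phi (x - 1) + integral {x - 1..y} std_normal_density)
      has_real_derivative std_normal_density x) (at x)" by simp
  have "eventually (\<lambda>y. y \<in> {x-1<..<x+1}) (nhds x)"
    by (intro eventually_nhds_in_open) auto
  then have ev: "eventually (\<lambda>y. Phi (x - 1) + integral {x - 1..y} std_normal_density = Phi y) (nhds x)"
    by eventually_elim (simp add: Phi_diff[symmetric])
  show ?thesis
    by (rule DERIV_cong_ev[OF refl ev refl, THEN iffD1, OF deriv])
qed

lemma isCont_Phi: "isCont Phi x"
  using DERIV_Phi by (rule DERIV_isCont)

lemma Phi_strict_mono: "x < y \<Longrightarrow> Phi x < Phi y"
  by (rule DERIV_pos_imp_increasing[of x y Phi])
    (auto intro!: exI[of _ "std_normal_density _"] DERIV_Phi normal_density_pos)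

lemma Phi_le_iff: "Phi x \<le> Phi y \<longleftrightarrow> x \<le> y"
  using Phi_strict_mono[of x y] Phi_strict_mono[of y x] by fastforce

lemma Phi_less_iff: "Phi x < Phi y \<longleftrightarrow> x < y"
  using Phi_le_iff[of y x] by linarith

lemma Phi_at_top: "(Phi \<longlongrightarrow> 1) at_top"
  unfolding Phi_def by (rule std_normal.cdf_lim_at_top_prob)

lemma Phi_at_bot: "(Phi \<longlongrightarrow> 0) at_bot"
  unfolding Phi_def by (rule std_normal.cdf_lim_at_bot)

text \<open>The density is even, so Phi x + Phi (- x) has derivative 0, and its constant value is
  read off at infinity.\<close>

lemma Phi_minus: "Phi (- x) = 1 - Phi x"
proof -
  have "((\<lambda>x. Phi x + Phi (- x)) has_real_derivative
      std_normal_density x + std_normal_density (- x) * (- 1)) (at x)" for x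
    by (intro DERIV_add DERIV_Phi DERIV_chain2[OF DERIV_Phi] DERIV_minus DERIV_ident)
  then have "\<forall>x. ((\<lambda>x. Phi x + Phi (- x)) has_real_derivative 0) (at x)"
    by (simp add: std_normal_density_def)
  then have "Phi y + Phi (- y) = Phi x + Phi (- x)" for y
    by (rule DERIV_isconst_all)
  then have const: "(\<lambda>y. Phi y + Phi (- y)) = (\<lambda>_. Phi x + Phi (- x))"
    by (intro ext)
  have "((\<lambda>y. Phi y + Phi (- y)) \<longlongrightarrow> 1 + 0) at_top"
    by (intro tendsto_add Phi_at_top filterlim_compose[OF Phi_at_bot filterlim_uminus_at_bot_at_top])
  then have "Phi x + Phi (- x) = 1"
    unfolding const by (simp add: tendsto_const_iff)
  then show ?thesis by simp
qed

lemma Phi_eq_ex: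
  assumes "0 < u" "u < 1"
  shows "\<exists>z. Phi z = u"
proof -
  obtain x where x: "Phi x > u"
    using order_tendstoD(1)[OF Phi_at_top assms(2)] by (auto simp: eventually_at_top_linorder)
  obtain y where y: "Phi y < u"
    using order_tendstoD(2)[OF Phi_at_bot assms(1)] by (auto simp: eventually_at_bot_linorder)
  have "y \<le> x" using x y Phi_less_iff[of y x] by linarith
  then show ?thesis
    using IVT[of Phi y u x] x y isCont_Phi by auto
qed

lemma Phi_diff_le: "\<bar>Phi x - Phi y\<bar> \<le> \<bar>x - y\<bar>"
proof -
  have "std_normal_density t \<le> 1" for t
  proof -
    have "1 \<le> sqrt (2 * pi)" using pi_ge_two by simp
    moreover have "exp (- t\<^sup>2 / 2) \<le> 1" by simp
    ultimately show ?thesis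
      unfolding std_normal_density_def by (intro mult_le_one) (auto simp: divide_le_eq)
  qed
  then have "norm (Phi x - Phi y) \<le> 1 * norm (x - y)"
    by (intro field_differentiable_bound[of UNIV Phi std_normal_density])
      (auto intro: has_field_derivative_at_within DERIV_Phi)
  then show ?thesis by simp
qed

text \<open>The standard normal mass of the interval of half-width z around b; b will be the bias in
  units of the standard deviation of the posterior mean.\<close>

definition coverage :: "real \<Rightarrow> real \<Rightarrow> real" where
  "coverage z b = Phi (b + z) - Phi (b - z)"

text \<open>The derivative in b is the density at b + z minus the density at b - z. It is negative
  for b > 0, because b + z is then farther from 0 than b - z.\<close>

lemma coverage_strict_decreasing:
  assumes "z > 0" "0 \<le> b" "b < c"
  shows "coverage z c < coverage z b"
proof (rule DERIV_neg_imp_decreasing_open[of b c "coverage z", OF assms(3)])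
  fix x assume x: "b < x" "x < c"
  have "(coverage z has_real_derivative std_normal_density (x + z) - std_normal_density (x - z)) (at x)"
    unfolding coverage_def[abs_def]
    by (auto intro!: derivative_eq_intros DERIV_chain2[OF DERIV_Phi])
  moreover have "0 < x * z" using x assms by simp
  then have "(x - z)\<^sup>2 < (x + z)\<^sup>2"
    by (simp add: power2_eq_square algebra_simps)
  then have "std_normal_density (x + z) < std_normal_density (x - z)"
    by (simp add: std_normal_density_def divide_strict_right_mono)
  ultimately show "\<exists>y. DERIV (coverage z) x :> y \<and> y < 0"
    by force
next
  show "continuous_on {b..c} (coverage z)"
    unfolding coverage_def[abs_def]
    by (intro continuous_at_imp_continuous_on ballI continuous_intros isCont_o2[OF _ isCont_Phi])
qed

text \<open>\<open>Phi\<close> is Lipschitz, so replacing \<rho> z by z changes the coverage by an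
  amount that vanishes uniformly in b, which may be unbounded. For the fixed width z, strict
  monotonicity forbids b to reach any given e > 0 infinitely often.\<close>

lemma coverage_tendsto_iff:
  assumes z: "z > 0" and b: "eventually (\<lambda>n. b n \<ge> 0) sequentially" and \<rho>: "\<rho> \<longlonglongrightarrow> 1"
  shows "(\<lambda>n. coverage (\<rho> n * z) (b n)) \<longlonglongrightarrow> coverage z 0 \<longleftrightarrow> b \<longlonglongrightarrow> 0"
proof -
  have double: "\<bar>p - q - (r - s)\<bar> \<le> 2 * w" if "\<bar>p - r\<bar> \<le> w" "\<bar>q - s\<bar> \<le> w" for p q r s w :: real
    using that by linarith
  have "(\<lambda>n. coverage (\<rho> n * z) (b n) - coverage z (b n)) \<longlonglongrightarrow> 0"
  proof (rule Lim_null_comparison[OF always_eventually])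
    show "\<forall>n. norm (coverage (\<rho> n * z) (b n) - coverage z (b n)) \<le> 2 * \<bar>\<rho> n * z - z\<bar>"
    proof
      fix n
      have "\<bar>Phi (b n + \<rho> n * z) - Phi (b n + z)\<bar> \<le> \<bar>\<rho> n * z - z\<bar>"
        using Phi_diff_le[of "b n + \<rho> n * z" "b n + z"] by simp
      moreover have "\<bar>Phi (b n - \<rho> n * z) - Phi (b n - z)\<bar> \<le> \<bar>\<rho> n * z - z\<bar>"
        using Phi_diff_le[of "b n - \<rho> n * z" "b n - z"] by (simp add: abs_minus_commute)
      ultimately show "norm (coverage (\<rho> n * z) (b n) - coverage z (b n)) \<le> 2 * \<bar>\<rho> n * z - z\<bar>"
        unfolding coverage_def real_norm_def by (rule double)
    qed
    have "(\<lambda>n. 2 * \<bar>\<rho> n * z - z\<bar>) \<longlonglongrightarrow> 2 * \<bar>1 * z - z\<bar>"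
      by (intro tendsto_intros \<rho>)
    then show "(\<lambda>n. 2 * \<bar>\<rho> n * z - z\<bar>) \<longlonglongrightarrow> 0" by simp
  qed
  then have "(\<lambda>n. coverage (\<rho> n * z) (b n)) \<longlonglongrightarrow> coverage z 0
      \<longleftrightarrow> (\<lambda>n. coverage z (b n)) \<longlonglongrightarrow> coverage z 0"
    by (rule Lim_transform_eq)
  also have "\<dots> \<longleftrightarrow> b \<longlonglongrightarrow> 0"
  proof
    assume "b \<longlonglongrightarrow> 0"
    then have "(\<lambda>n. coverage z (b n)) \<longlonglongrightarrow> Phi (0 + z) - Phi (0 - z)"
      unfolding coverage_def by (intro tendsto_intros isCont_tendsto_compose[OF isCont_Phi])
    then show "(\<lambda>n. coverage z (b n)) \<longlonglongrightarrow> coverage z 0" by (simp add: coverage_def)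
  next
    assume lim: "(\<lambda>n. coverage z (b n)) \<longlonglongrightarrow> coverage z 0"
    show "b \<longlonglongrightarrow> 0"
    proof (rule order_tendstoI)
      fix e :: real assume "e > 0"
      then have "eventually (\<lambda>n. coverage z (b n) > coverage z e) sequentially"
        by (intro order_tendstoD(1)[OF lim] coverage_strict_decreasing[OF z]) auto
      then show "eventually (\<lambda>n. b n < e) sequentially"
      proof eventually_elim
        case (elim n)
        show ?case
        proof (rule ccontr)
          assume "\<not> b n < e"
          then have "coverage z (b n) \<le> coverage z e"
            using coverage_strict_decreasing[OF z, of e "b n"] \<open>e > 0\<close>
            by (cases "b n = e") auto
          then show False using elim by simp
        qed
      qed
    next
      fix e :: real assume "e < 0"
      then show "eventually (\<lambda>n. b n > e) sequentially"
        using b by (auto elim: eventually_mono)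
    qed
  qed
  finally show ?thesis .
qed

section \<open>Quantiles and interval masses of normal laws\<close>

lemma cdf_normal_distribution:
  assumes "\<sigma> > 0"
  shows "cdf (normal_distribution m \<sigma>) x = Phi ((x - m) / \<sigma>)"
proof -
  have "(\<lambda>t. m + \<sigma> * t) -` {..x} = {..(x - m) / \<sigma>}"
    using assms by (auto simp: field_simps)
  then show ?thesis
    unfolding normal_distribution_affine[OF assms] Phi_def cdf_def
    by (subst measure_distr) auto
qed

lemma quantile_normal_distribution:
  assumes "\<sigma> > 0"
  shows "quantile (normal_distribution m \<sigma>) (Phi z) = m + \<sigma> * z"
proof -
  have "{x. Phi z \<le> cdf (normal_distribution m \<sigma>) x} = {m + \<sigma> * z..}"
    using assms by (auto simp: cdf_normal_distribution Phi_le_iff field_simps)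
  then show ?thesis by (simp add: quantile_def)
qed

lemma mean_normal_distribution:
  assumes "\<sigma> > 0"
  shows "mean (normal_distribution m \<sigma>) = m"
  unfolding mean_def using assms
  by (subst integral_density) (auto simp: integral_normal_moment_nz_1)

lemma corrected_interval_normal:
  assumes "\<sigma> > 0" and z: "Phi z = 1 - \<delta> / 2"
  shows "corrected_interval \<alpha> \<delta> (normal_distribution m \<sigma>) =
    {m - sqrt \<alpha> * \<sigma> * z <.. m + sqrt \<alpha> * \<sigma> * z}"
proof -
  have "\<delta> / 2 = Phi (- z)" using z by (simp add: Phi_minus)
  then have "quantile (normal_distribution m \<sigma>) (\<delta> / 2) = m - \<sigma> * z"
    using quantile_normal_distribution[OF assms(1), of m "- z"] by simp
  moreover have "quantile (normal_distribution m \<sigma>) (1 - \<delta> / 2) = m + \<sigma> * z"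
    using quantile_normal_distribution[OF assms(1), of m z] z by simp
  ultimately show ?thesis
    using assms by (simp add: corrected_interval_def mean_normal_distribution ac_simps)
qed

text \<open>The brackets mirror those of the corrected interval: solving its two inequalities for
  the noise exchanges the open and the closed end.\<close>

lemma measure_normal_distribution_Ico:
  assumes "\<sigma> > 0" "l \<le> h"
  shows "measure (normal_distribution 0 \<sigma>) {l..<h} = Phi (h / \<sigma>) - Phi (l / \<sigma>)"
proof -
  interpret N: real_distribution "normal_distribution 0 \<sigma>"
    using assms by (intro real_distribution_normal)
  have null: "AE x in normal_distribution 0 \<sigma>. x \<noteq> y" for y
    by (subst AE_density) (auto intro: AE_mp[OF AE_lborel_singleton])
  have "measure (normal_distribution 0 \<sigma>) {l..<h} = measure (normal_distribution 0 \<sigma>) {l<..h}"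
  proof (rule N.finite_measure_eq_AE)
    show "AE x in normal_distribution 0 \<sigma>. x \<in> {l..<h} \<longleftrightarrow> x \<in> {l<..h}"
      using null[of l] null[of h] by eventually_elim auto
  qed auto
  also have "\<dots> = Phi (h / \<sigma>) - Phi (l / \<sigma>)"
  proof (cases "l = h")
    case False
    then show ?thesis
      using N.cdf_diff_eq[of l h] assms by (simp add: cdf_normal_distribution)
  qed simp
  finally show ?thesis .
qed

section \<open>Measurability of the coverage event\<close>

text \<open>Right continuity of the cdf makes the infimum attained, and u strictly between 0 and 1
  makes the set nonempty and bounded below. Measurability of quantiles in the observation thereby
  reduces to that of the cdf at one point.\<close>

lemma quantile_le_iff:
  assumes "real_distribution M" and u: "0 < u" "u < 1"
  shows "quantile M u \<le> q \<longleftrightarrow> u \<le> cdf M q"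
proof -
  interpret real_distribution M by fact
  let ?S = "{x. u \<le> cdf M x}"
  obtain y where y: "\<And>x. x \<le> y \<Longrightarrow> cdf M x < u"
    using order_tendstoD(2)[OF cdf_lim_at_bot u(1)] by (auto simp: eventually_at_bot_linorder)
  have bdd: "bdd_below ?S"
  proof (rule bdd_belowI)
    fix x assume "x \<in> ?S"
    then have "\<not> cdf M x < u" by simp
    then show "y \<le> x" using y[of x] by linarith
  qed
  obtain x where "cdf M x > u"
    using order_tendstoD(1)[OF cdf_lim_at_top_prob u(2)] by (auto simp: eventually_at_top_linorder)
  then have ne: "?S \<noteq> {}" by (auto intro: less_imp_le)
  show ?thesis
  proof
    assume "u \<le> cdf M q"
    then show "quantile M u \<le> q" unfolding quantile_def by (intro cInf_lower bdd) simp
  next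
    assume q: "quantile M u \<le> q"
    have ge: "u \<le> cdf M x" if "q < x" for x
    proof -
      have "Inf ?S < x" using q that by (simp add: quantile_def)
      then obtain w where "w \<in> ?S" "w < x" using cInf_less_iff[OF ne bdd] by blast
      then show ?thesis using cdf_nondecreasing[of w x] by simp
    qed
    have "(cdf M \<longlongrightarrow> cdf M q) (at_right q)"
      using cdf_is_right_cont by (simp add: continuous_within)
    then show "u \<le> cdf M q"
      by (rule tendsto_lowerbound) (auto simp: eventually_at_right_field intro!: ge exI[of _ "q + 1"])
  qed
qed

context white_noise_model
begin

definition lik :: "real \<Rightarrow> nat \<Rightarrow> (nat \<Rightarrow> real) \<Rightarrow> (real \<Rightarrow> real) \<Rightarrow> real" where
  "lik \<alpha> n Y f = exp (\<alpha> * log_likelihood \<phi> n Y f)"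

definition evidence :: "real \<Rightarrow> nat \<Rightarrow> (nat \<Rightarrow> real) \<Rightarrow> ennreal" where
  "evidence \<alpha> n Y = (\<integral>\<^sup>+f. ennreal (lik \<alpha> n Y f) \<partial>prior)"

abbreviation obs :: "(nat \<Rightarrow> real) measure" where
  "obs \<equiv> \<Pi>\<^sub>M k\<in>(UNIV :: nat set). (borel :: real measure)"

text \<open>
  Measures vanish on non-measurable sets, so the coverage event must be measurable in the
  observation everywhere, including at the null set of observations with infinite evidence,
  where division by \<open>top\<close> makes the posterior the null measure.
\<close>

lemma lik_measurable [measurable]:
  "case_prod (lik \<alpha> n) \<in> borel_measurable (obs \<Otimes>\<^sub>M prior)"
  unfolding lik_def log_likelihood_def by measurable

lemma evidence_measurable [measurable]: "evidence \<alpha> n \<in> borel_measurable obs"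
  unfolding evidence_def by measurable

lemma evidence_pos: "evidence \<alpha> n Y > 0" if "Y \<in> space obs"
proof -
  have [measurable]: "lik \<alpha> n Y \<in> borel_measurable prior"
    using measurable_compose[OF measurable_Pair1'[OF that] lik_measurable] by simp
  have "evidence \<alpha> n Y \<noteq> 0"
    unfolding evidence_def
    by (subst nn_integral_0_iff_AE) (measurable, simp add: lik_def ennreal_eq_0_iff not_le prior.AE_False)
  then show ?thesis by (simp add: zero_less_iff_neq_zero)
qed

text \<open>The evidence is positive, so the quotient is finite and passes to the reals without
  loss; at infinite evidence it is 0. A real density allows the posterior mean to be written as an
  integral over the prior.\<close>

definition posterior_density :: "real \<Rightarrow> nat \<Rightarrow> (nat \<Rightarrow> real) \<Rightarrow> (real \<Rightarrow> real) \<Rightarrow> real" where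
  "posterior_density \<alpha> n Y f = enn2real (ennreal (lik \<alpha> n Y f) / evidence \<alpha> n Y)"

lemma posterior_density_measurable [measurable]:
  "case_prod (posterior_density \<alpha> n) \<in> borel_measurable (obs \<Otimes>\<^sub>M prior)"
  unfolding posterior_density_def by measurable

lemma frac_posterior_eq:
  assumes "Y \<in> space obs"
  shows "frac_posterior prior \<phi> \<alpha> n Y = density prior (\<lambda>f. ennreal (posterior_density \<alpha> n Y f))"
proof -
  have "ennreal (lik \<alpha> n Y f) / evidence \<alpha> n Y < top" for f
    using evidence_pos[OF assms, of \<alpha> n] by (simp add: ennreal_divide_eq_top_iff less_top[symmetric] zero_less_iff_neq_zero)
  then have "ennreal (posterior_density \<alpha> n Y f) = ennreal (lik \<alpha> n Y f) / evidence \<alpha> n Y" for f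
    by (simp add: posterior_density_def)
  then show ?thesis by (simp add: frac_posterior_def evidence_def lik_def)
qed

lemma posterior_density_section [measurable]:
  "Y \<in> space obs \<Longrightarrow> posterior_density \<alpha> n Y \<in> borel_measurable prior"
  using measurable_compose[OF measurable_Pair1' posterior_density_measurable] by simp

lemma posterior_density_nonneg: "posterior_density \<alpha> n Y f \<ge> 0"
  by (simp add: posterior_density_def)

lemma cdf_posterior_measurable:
  "(\<lambda>Y. cdf (functional_posterior prior \<phi> a \<alpha> n Y) q) \<in> borel_measurable obs"
proof (subst measurable_cong)
  fix Y assume Y: "Y \<in> space obs"
  let ?A = "linear_functional a -` {..q} \<inter> space prior"
  have "cdf (functional_posterior prior \<phi> a \<alpha> n Y) q
      = measure (density prior (\<lambda>f. ennreal (posterior_density \<alpha> n Y f))) ?A"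
    unfolding cdf_def functional_posterior_def frac_posterior_eq[OF Y]
    by (subst measure_distr) auto
  also have "\<dots> = enn2real (\<integral>\<^sup>+f. ennreal (posterior_density \<alpha> n Y f) * indicator ?A f \<partial>prior)"
    using Y by (simp add: measure_def emeasure_density)
  finally show "cdf (functional_posterior prior \<phi> a \<alpha> n Y) q
      = enn2real (\<integral>\<^sup>+f. ennreal (posterior_density \<alpha> n Y f) * indicator ?A f \<partial>prior)" .
qed measurable

lemma mean_posterior_measurable:
  "(\<lambda>Y. mean (functional_posterior prior \<phi> a \<alpha> n Y)) \<in> borel_measurable obs"
proof (subst measurable_cong)
  fix Y assume Y: "Y \<in> space obs"
  show "mean (functional_posterior prior \<phi> a \<alpha> n Y)
      = (\<integral>f. posterior_density \<alpha> n Y f * linear_functional a f \<partial>prior)"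
    unfolding mean_def functional_posterior_def frac_posterior_eq[OF Y]
    using Y by (subst integral_distr, simp, simp, subst integral_density)
      (auto simp: posterior_density_nonneg)
qed measurable

lemma quantile_posterior_measurable:
  assumes u: "0 < u" "u < 1"
  shows "(\<lambda>Y. quantile (functional_posterior prior \<phi> a \<alpha> n Y) u) \<in> borel_measurable obs"
proof (subst borel_measurable_iff_le, intro allI)
  fix q
  let ?\<nu> = "\<lambda>Y. functional_posterior prior \<phi> a \<alpha> n Y"
  \<comment> \<open>Under infinite evidence the cdf vanishes, so no x qualifies for u > 0 and
    \<open>quantile\<close> is the infimum of the empty set: some fixed real, hence harmless for
    measurability.\<close>
  have *: "quantile (?\<nu> Y) u \<le> q \<longleftrightarrow>
      (if evidence \<alpha> n Y = top then Inf {} \<le> q else u \<le> cdf (?\<nu> Y) q)"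
    if Y: "Y \<in> space obs" for Y
  proof (cases "evidence \<alpha> n Y = top")
    case True
    then have "posterior_density \<alpha> n Y f = 0" for f
      by (simp add: posterior_density_def)
    then have "cdf (?\<nu> Y) x = 0" for x
      unfolding cdf_def functional_posterior_def frac_posterior_eq[OF Y]
      by (subst measure_distr) (auto simp: measure_def emeasure_density)
    then show ?thesis using u True by (simp add: quantile_def)
  next
    case False
    have [measurable]: "lik \<alpha> n Y \<in> borel_measurable prior"
      using measurable_compose[OF measurable_Pair1'[OF Y] lik_measurable] by simp
    have "emeasure (frac_posterior prior \<phi> \<alpha> n Y) (space (frac_posterior prior \<phi> \<alpha> n Y))
        = (\<integral>\<^sup>+f. ennreal (lik \<alpha> n Y f) / evidence \<alpha> n Y \<partial>prior)"
      unfolding frac_posterior_def lik_def[symmetric] evidence_def[symmetric]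
      by (simp add: emeasure_density cong: nn_integral_cong)
    also have "\<dots> = evidence \<alpha> n Y / evidence \<alpha> n Y"
      by (subst nn_integral_divide) (simp_all add: evidence_def)
    also have "\<dots> = 1"
      using False evidence_pos[OF Y, of \<alpha> n] by (intro ennreal_divide_self) (auto simp: less_top)
    finally interpret post: prob_space "frac_posterior prior \<phi> \<alpha> n Y" by (intro prob_spaceI)
    have "linear_functional a \<in> borel_measurable (frac_posterior prior \<phi> \<alpha> n Y)"
      by (simp add: frac_posterior_def)
    then have "real_distribution (?\<nu> Y)"
      unfolding functional_posterior_def by (rule post.real_distribution_distr)
    then show ?thesis using False u by (simp add: quantile_le_iff)
  qed
  have "{Y \<in> space obs. quantile (?\<nu> Y) u \<le> q}
      = {Y \<in> space obs. if evidence \<alpha> n Y = top then Inf {} \<le> q else u \<le> cdf (?\<nu> Y) q}"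
    using * by auto
  also have "\<dots> \<in> sets obs"
    using cdf_posterior_measurable[of \<alpha> n q, measurable] by measurable
  finally show "{Y \<in> space obs. quantile (?\<nu> Y) u \<le> q} \<in> sets obs" .
qed

lemma corrected_interval_measurable:
  assumes "0 < \<delta>" "\<delta> < 1"
  shows "{Y \<in> space obs. \<psi> \<in> corrected_interval \<alpha> \<delta> (functional_posterior prior \<phi> a \<alpha>' n Y)} \<in> sets obs"
proof -
  have [measurable]: "(\<lambda>Y. mean (functional_posterior prior \<phi> a \<alpha>' n Y)) \<in> borel_measurable obs"
    by (rule mean_posterior_measurable)
  have [measurable]: "(\<lambda>Y. quantile (functional_posterior prior \<phi> a \<alpha>' n Y) (\<delta> / 2)) \<in> borel_measurable obs"
    "(\<lambda>Y. quantile (functional_posterior prior \<phi> a \<alpha>' n Y) (1 - \<delta> / 2)) \<in> borel_measurable obs"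
    using assms by (auto intro!: quantile_posterior_measurable)
  show ?thesis
    unfolding corrected_interval_def greaterThanAtMost_iff by measurable
qed

end

section \<open>The coverage probability\<close>

context gaussian_sequence
begin

text \<open>By monotone convergence the sum of squares has expectation equal to the sum of
  \<open>lam\<close>, hence is finite almost surely.\<close>

lemma AE_summable_square:
  assumes "summable lam"
  shows "AE \<omega> in M. summable (\<lambda>k. (X k \<omega>)\<^sup>2)"
proof -
  have "(\<integral>\<^sup>+\<omega>. (\<Sum>k. ennreal ((X k \<omega>)\<^sup>2)) \<partial>M) = (\<Sum>k. \<integral>\<^sup>+\<omega>. ennreal ((X k \<omega>)\<^sup>2) \<partial>M)"
    by (rule nn_integral_suminf) simp
  also have "\<dots> = (\<Sum>k. ennreal (lam k))"
    using integrable_X_square by (subst nn_integral_eq_integral) (simp_all add: expectation_X_square)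
  also have "\<dots> = ennreal (\<Sum>k. lam k)"
    using assms lam_pos by (intro suminf_ennreal2) (auto simp: less_imp_le)
  finally have "AE \<omega> in M. (\<Sum>k. ennreal ((X k \<omega>)\<^sup>2)) \<noteq> \<infinity>"
    by (intro nn_integral_PInf_AE) auto
  then show ?thesis
    by eventually_elim (auto intro: summable_suminf_not_top)
qed

lemma scaled:
  assumes "\<And>k. c k > 0"
  shows "gaussian_sequence M (\<lambda>k \<omega>. X k \<omega> * c k) (\<lambda>k. lam k * (c k)\<^sup>2)"
proof unfold_locales
  show "indep_vars (\<lambda>_. borel) (\<lambda>k \<omega>. X k \<omega> * c k) UNIV"
    by (rule indep_vars_compose2[OF indep]) measurable
  fix k
  have "c k \<noteq> 0" "c k > 0" using assms[of k] by auto
  then show "distributed M lborel (\<lambda>\<omega>. X k \<omega> * c k) (normal_density 0 (sqrt (lam k * (c k)\<^sup>2)))"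
    using normal_density_affine[OF normal[of k], of "c k" 0] lam_pos[of k]
    by (simp add: real_sqrt_mult mult.commute)
  show "lam k * (c k)\<^sup>2 > 0" using assms[of k] lam_pos[of k] by simp
qed

text \<open>The posterior computation with no tilt, \<kappa> = 0, and unit weights: the density is 1
  and the tilted variances are \<open>lam\<close> itself.\<close>

lemma distr_series:
  assumes "summable lam"
  shows "distr M borel (\<lambda>\<omega>. \<Sum>k. X k \<omega>) = normal_distribution 0 (sqrt (\<Sum>k. lam k))"
proof -
  have hyps: "(0::real) \<ge> 0" "summable (\<lambda>k. lam k * 0\<^sup>2)" "summable (\<lambda>k. lam k * 1\<^sup>2)"
    using assms by simp_all
  note X2 = AE_summable_square[OF assms]
  have D: "tilt_density 0 (\<lambda>_. 0) = (\<lambda>_. 1)"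
    by (rule ext) (simp add: tilt_density_def[OF hyps X2])
  have "distr M borel (\<lambda>\<omega>. \<Sum>k. X k \<omega>) = distr (density M (\<lambda>\<omega>. ennreal (tilt_density 0 (\<lambda>_. 0) \<omega>
      / expectation (tilt_density 0 (\<lambda>_. 0))))) borel (\<lambda>\<omega>. \<Sum>k. X k \<omega> * 1)"
    by (simp add: D prob_space density_1)
  also have "\<dots> = normal_distribution 0 (sqrt (\<Sum>k. lam k))"
    by (subst distr_tilted_functional[OF hyps X2]) (simp_all add: tilted_var_def[OF hyps X2])
  finally show ?thesis .
qed

end

section \<open>The noise as a Gaussian sequence\<close>

abbreviation noise :: "(nat \<Rightarrow> real) measure" where
  "noise \<equiv> \<Pi>\<^sub>M k\<in>(UNIV :: nat set). std_normal_distribution"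

lemma gaussian_sequence_noise: "gaussian_sequence noise (\<lambda>k \<epsilon>. \<epsilon> k) (\<lambda>_. 1)"
proof -
  have ps: "prob_space std_normal_distribution" by (rule prob_space_normal_density) simp
  interpret N: product_prob_space "\<lambda>_::nat. std_normal_distribution" UNIV
    using ps by (simp add: product_prob_space_def product_prob_space_axioms_def product_sigma_finite_def
        prob_space_imp_sigma_finite)
  have comp: "distr noise borel (\<lambda>\<epsilon>. \<epsilon> k) = std_normal_distribution" for k
  proof -
    have "distr noise borel (\<lambda>\<epsilon>. \<epsilon> k) = distr noise std_normal_distribution (\<lambda>\<epsilon>. \<epsilon> k)"
      by (rule distr_cong) simp_all
    also have "\<dots> = std_normal_distribution" by (rule distr_PiM_component[OF ps]) simp
    finally show ?thesis .
  qed
  have "sets noise = sets (\<Pi>\<^sub>M k\<in>(UNIV :: nat set). (borel :: real measure))"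
    by (intro sets_PiM_cong) auto
  then have "distr noise (\<Pi>\<^sub>M k\<in>UNIV. borel) (\<lambda>\<epsilon>. \<lambda>k\<in>UNIV. \<epsilon> k) = noise"
    by (simp add: restrict_UNIV distr_id2)
  then have ind: "prob_space.indep_vars noise (\<lambda>_. borel) (\<lambda>k \<epsilon>. \<epsilon> k) UNIV"
    by (subst N.P.indep_vars_iff_distr_eq_PiM') (auto simp: comp)
  show ?thesis
  proof (unfold_locales, rule ind)
    show "distributed noise lborel (\<lambda>\<epsilon>. \<epsilon> k) (normal_density 0 (sqrt 1))" for k
      unfolding distributed_def using comp[of k] by (simp cong: distr_cong)
  qed simp
qed

context white_noise_model
begin

text \<open>The posterior mean is psi(f0) - b + G / sqrt n: the shrinkage weights w cause the
  deterministic bias b and filter the noise into a centred Gaussian series G with standard deviation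
  \<tau>. Covering psi(f0) becomes an event about G alone.\<close>

lemma coverage_probability:
  fixes n :: nat
  assumes f0: "f0 \<in> L2" and n: "n \<ge> 1" and \<alpha>: "\<alpha> > 0" and \<delta>: "0 < \<delta>" "\<delta> < 1"
    and z: "Phi z = 1 - \<delta> / 2" "z > 0"
  defines "w \<equiv> \<lambda>k. real n * \<alpha> * lam k / (1 + real n * \<alpha> * lam k)"
  defines "\<tau> \<equiv> sqrt (\<Sum>k. (w k * coef \<phi> a k)\<^sup>2)"
  shows "measure (white_noise_law \<phi> n f0) {Y \<in> space (white_noise_law \<phi> n f0).
      linear_functional a f0 \<in> corrected_interval \<alpha> \<delta> (functional_posterior prior \<phi> a \<alpha> n Y)}
    = coverage (sqrt (\<Sum>k. w k * (coef \<phi> a k)\<^sup>2) / \<tau> * z)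
       (sqrt (real n) * (\<Sum>k. coef \<phi> f0 k * coef \<phi> a k / (1 + real n * \<alpha> * lam k)) / \<tau>)"
proof -
  interpret E: gaussian_sequence noise "\<lambda>k \<epsilon>. \<epsilon> k" "\<lambda>_. 1" by (rule gaussian_sequence_noise)
  define \<kappa> where "\<kappa> = real n * \<alpha>"
  define A where "A = coef \<phi> a"
  define F where "F = coef \<phi> f0"
  define s where "s k = lam k / (1 + \<kappa> * lam k)" for k
  define b where "b = (\<Sum>k. F k * A k / (1 + \<kappa> * lam k))"
  define r where "r = sqrt \<alpha> * sqrt (\<Sum>k. s k * (A k)\<^sup>2) * z"
  define G where "G \<epsilon> = (\<Sum>k. \<epsilon> k * (w k * A k))" for \<epsilon> :: "nat \<Rightarrow> real"
  define Y where "Y \<epsilon> k = F k + \<epsilon> k / sqrt (real n)" for \<epsilon> :: "nat \<Rightarrow> real" and k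
  have \<kappa>: "\<kappa> > 0" using n \<alpha> by (simp add: \<kappa>_def)
  have p: "1 + \<kappa> * lam k > 0" for k using \<kappa> lam_pos[of k] by (simp add: add_pos_pos)
  have A: "A k > 0" for k using coef_a_pos by (simp add: A_def)
  have w: "w k = \<kappa> * s k" for k by (simp add: w_def s_def \<kappa>_def)
  have s_pos: "s k > 0" for k using p lam_pos by (simp add: s_def)
  have w_pos: "w k > 0" for k using s_pos \<kappa> by (simp add: w)
  have w_le: "w k \<le> 1" for k
    using p[of k] unfolding w s_def by (simp add: divide_le_eq)
  \<comment> \<open>The share of the k-th coefficient that shrinkage removes; this gives the bias
    its form.\<close>
  have w_compl: "1 / (1 + \<kappa> * lam k) = 1 - w k" for k
    using p[of k] unfolding w s_def by (simp add: field_simps)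
  have A2: "summable (\<lambda>k. (A k)\<^sup>2)" and F2: "summable (\<lambda>k. (F k)\<^sup>2)"
    using coef_square_sums[OF basis a] coef_square_sums[OF basis f0] by (auto simp: sums_iff A_def F_def)
  have FA: "(\<lambda>k. F k * A k) sums linear_functional a f0"
    using linear_functional_sums[OF f0] by (simp add: F_def A_def)
  have wA2: "summable (\<lambda>k. (w k * A k)\<^sup>2)"
    using w_pos w_le
    by (intro summable_comparison_test'[OF A2, of 0])
      (auto simp: power_mult_distrib less_imp_le power_le_one intro!: mult_left_le_one_le)
  have s_le: "s k \<le> lam k" for k
    using p[of k] \<kappa> lam_pos[of k] by (simp add: s_def divide_le_eq mult_le_cancel_left1)
  have sA2: "summable (\<lambda>k. s k * (A k)\<^sup>2)"
    using s_pos s_le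
    by (intro summable_comparison_test'[OF summable_lam_mult[OF A2], of 0])
      (auto simp: abs_mult abs_of_pos intro!: mult_right_mono)
  have wFA: "summable (\<lambda>k. w k * (F k * A k))"
  proof (rule summable_comparison_test'[OF summable_add[OF F2 A2]])
    fix k
    have "\<bar>F k\<bar> * \<bar>A k\<bar> \<le> (F k)\<^sup>2 + (A k)\<^sup>2"
      using sum_squares_bound[of "\<bar>F k\<bar>" "\<bar>A k\<bar>"] mult_nonneg_nonneg[of "\<bar>F k\<bar>" "\<bar>A k\<bar>"]
      unfolding power2_abs by linarith
    moreover have "\<bar>w k\<bar> * (\<bar>F k\<bar> * \<bar>A k\<bar>) \<le> \<bar>F k\<bar> * \<bar>A k\<bar>"
      using w_pos[of k] w_le[of k] by (intro mult_left_le_one_le) auto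
    ultimately show "norm (w k * (F k * A k)) \<le> (F k)\<^sup>2 + (A k)\<^sup>2"
      by (simp add: abs_mult)
  qed
  have b: "b = linear_functional a f0 - (\<Sum>k. w k * (F k * A k))"
  proof -
    have "F k * A k / (1 + \<kappa> * lam k) = F k * A k - w k * (F k * A k)" for k
    proof -
      have "F k * A k / (1 + \<kappa> * lam k) = F k * A k * (1 / (1 + \<kappa> * lam k))" by simp
      also have "\<dots> = F k * A k - w k * (F k * A k)" unfolding w_compl by (simp add: algebra_simps)
      finally show ?thesis .
    qed
    then show ?thesis
      using FA suminf_diff[OF _ wFA, of "\<lambda>k. F k * A k"] by (simp add: b_def sums_iff)
  qed
  \<comment> \<open>Two rescalings of the noise: by w_k a_k to obtain the law of G, and by sqrt
    lam_k, whose summable variances make the series of lam_k \<epsilon>_k^2 converge almost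
    surely.\<close>
  interpret W: gaussian_sequence noise "\<lambda>k \<epsilon>. \<epsilon> k * (w k * A k)" "\<lambda>k. 1 * (w k * A k)\<^sup>2"
    by (rule E.scaled) (simp add: w_pos A)
  interpret L: gaussian_sequence noise "\<lambda>k \<epsilon>. \<epsilon> k * sqrt (lam k)" "\<lambda>k. 1 * (sqrt (lam k))\<^sup>2"
    by (rule E.scaled) (simp add: lam_pos)
  have lam_sqrt: "(sqrt (lam k))\<^sup>2 = lam k" for k using lam_pos[of k] by simp
  have AE1: "AE \<epsilon> in noise. summable (\<lambda>k. \<epsilon> k * (w k * A k))"
    using W.AE_summable_X_mult[of "\<lambda>_. 1"] wA2 by simp
  have AE2: "AE \<epsilon> in noise. summable (\<lambda>k. (\<epsilon> k)\<^sup>2 * lam k)"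
    using L.AE_summable_square lam_summable by (simp add: lam_sqrt power_mult_distrib)
  have AE: "AE \<epsilon> in noise. (linear_functional a f0
        \<in> corrected_interval \<alpha> \<delta> (functional_posterior prior \<phi> a \<alpha> n (Y \<epsilon>)))
      \<longleftrightarrow> G \<epsilon> \<in> {sqrt (real n) * (b - r)..<sqrt (real n) * (b + r)}"
    using AE1 AE2
  proof eventually_elim
    case (elim \<epsilon>)
    \<comment> \<open>Signal and noise are both square summable against \<open>lam\<close>, and
      dividing the noise by sqrt n \<ge> 1 only helps.\<close>
    have "summable (\<lambda>k. lam k * (Y \<epsilon> k)\<^sup>2)"
    proof (rule summable_comparison_test')
      show "summable (\<lambda>k. 2 * (lam k * (F k)\<^sup>2) + 2 * ((\<epsilon> k)\<^sup>2 * lam k))"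
        using summable_lam_mult[OF F2] elim by (intro summable_add summable_mult) auto
      fix k
      have "(Y \<epsilon> k)\<^sup>2 \<le> 2 * (F k)\<^sup>2 + 2 * (\<epsilon> k / sqrt (real n))\<^sup>2"
        using sum_squares_bound[of "F k" "\<epsilon> k / sqrt (real n)"] by (simp add: Y_def power2_sum)
      also have "(\<epsilon> k / sqrt (real n))\<^sup>2 \<le> (\<epsilon> k)\<^sup>2"
        using n by (simp add: power_divide divide_le_eq mult_le_cancel_left1)
      finally have "lam k * (Y \<epsilon> k)\<^sup>2 \<le> lam k * (2 * (F k)\<^sup>2 + 2 * (\<epsilon> k)\<^sup>2)"
        using lam_pos[of k] by (intro mult_left_mono) auto
      then show "norm (lam k * (Y \<epsilon> k)\<^sup>2) \<le> 2 * (lam k * (F k)\<^sup>2) + 2 * ((\<epsilon> k)\<^sup>2 * lam k)"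
        using lam_pos[of k] by (simp add: algebra_simps)
    qed
    then have post: "functional_posterior prior \<phi> a \<alpha> n (Y \<epsilon>)
        = normal_distribution (\<Sum>k. A k * (\<kappa> * Y \<epsilon> k * s k)) (sqrt (\<Sum>k. s k * (A k)\<^sup>2))"
      using functional_posterior_normal[of \<alpha> "Y \<epsilon>" n] \<alpha> by (simp add: A_def s_def \<kappa>_def)
    have "(\<Sum>k. A k * (\<kappa> * Y \<epsilon> k * s k)) = (\<Sum>k. w k * (F k * A k) + \<epsilon> k * (w k * A k) / sqrt (real n))"
      by (simp add: w Y_def algebra_simps)
    also have "\<dots> = (\<Sum>k. w k * (F k * A k)) + G \<epsilon> / sqrt (real n)"
      unfolding G_def using elim
      by (subst suminf_add[symmetric]) (auto intro: wFA summable_divide simp: suminf_divide)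
    finally have mean: "(\<Sum>k. A k * (\<kappa> * Y \<epsilon> k * s k)) = linear_functional a f0 - b + G \<epsilon> / sqrt (real n)"
      by (simp add: b)
    have "(\<Sum>k. s k * (A k)\<^sup>2) > 0"
      using s_pos A by (intro suminf_pos sA2) (simp add: less_imp_neq[symmetric])
    then have "corrected_interval \<alpha> \<delta> (functional_posterior prior \<phi> a \<alpha> n (Y \<epsilon>))
        = {linear_functional a f0 - b + G \<epsilon> / sqrt (real n) - r <..
           linear_functional a f0 - b + G \<epsilon> / sqrt (real n) + r}"
      unfolding post mean r_def by (intro corrected_interval_normal z) simp
    moreover have "sqrt (real n) > 0" using n by simp
    ultimately show ?case
      by (auto simp: field_simps)
  qed
  have G_meas: "G \<in> borel_measurable noise"
    unfolding G_def by measurable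
  have Y_meas: "Y \<in> measurable noise obs"
    unfolding Y_def by (rule measurable_PiM_single') auto
  let ?S = "{Y \<in> space obs. linear_functional a f0
      \<in> corrected_interval \<alpha> \<delta> (functional_posterior prior \<phi> a \<alpha> n Y)}"
  have S: "?S \<in> sets obs" by (rule corrected_interval_measurable[OF \<delta>])
  have law: "white_noise_law \<phi> n f0 = distr noise obs Y"
    unfolding white_noise_law_def Y_def F_def ..
  have "measure (white_noise_law \<phi> n f0) {Y \<in> space (white_noise_law \<phi> n f0).
      linear_functional a f0 \<in> corrected_interval \<alpha> \<delta> (functional_posterior prior \<phi> a \<alpha> n Y)}
    = E.prob (Y -` ?S \<inter> space noise)"
    unfolding law space_distr using Y_meas S by (rule measure_distr)
  \<comment> \<open>The events agree up to a null set, but equality of their measures also needs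
    both to be measurable; the measurability of the coverage event over all observations is used
    here.\<close>
  also have "\<dots> = E.prob (G -` {sqrt (real n) * (b - r)..<sqrt (real n) * (b + r)} \<inter> space noise)"
  proof (rule E.finite_measure_eq_AE)
    show "AE \<epsilon> in noise. (\<epsilon> \<in> Y -` ?S \<inter> space noise)
        \<longleftrightarrow> (\<epsilon> \<in> G -` {sqrt (real n) * (b - r)..<sqrt (real n) * (b + r)} \<inter> space noise)"
      using AE AE_space by eventually_elim (auto simp: space_PiM)
  qed (use G_meas Y_meas S in \<open>auto intro: measurable_sets\<close>)
  also have "\<dots> = measure (distr noise borel G) {sqrt (real n) * (b - r)..<sqrt (real n) * (b + r)}"
    using G_meas by (subst measure_distr) auto
  also have "distr noise borel G = normal_distribution 0 \<tau>"
    unfolding G_def \<tau>_def using W.distr_series wA2 by (simp add: A_def)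
  also have "measure (normal_distribution 0 \<tau>) {sqrt (real n) * (b - r)..<sqrt (real n) * (b + r)}
      = Phi (sqrt (real n) * (b + r) / \<tau>) - Phi (sqrt (real n) * (b - r) / \<tau>)"
  proof (rule measure_normal_distribution_Ico)
    have "(\<Sum>k. (w k * A k)\<^sup>2) > 0"
      using w_pos A by (intro suminf_pos wA2) (simp add: less_imp_neq[symmetric])
    then show "\<tau> > 0" by (simp add: \<tau>_def A_def)
    have "r \<ge> 0"
      unfolding r_def using z(2) \<alpha> s_pos
      by (intro mult_nonneg_nonneg real_sqrt_ge_zero suminf_nonneg sA2) (auto simp: less_imp_le)
    then show "sqrt (real n) * (b - r) \<le> sqrt (real n) * (b + r)"
      by (intro mult_left_mono) auto
  qed
  also have "\<dots> = coverage (sqrt (real n) * r / \<tau>) (sqrt (real n) * b / \<tau>)"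
    by (simp add: coverage_def ring_distribs add_divide_distrib diff_divide_distrib)
  \<comment> \<open>The effect of the correction: sqrt \<alpha> supplies the factor that turns n s_k
    into n \<alpha> s_k = w_k under the root, so \<alpha> influences the rescaled half-width only
    through w.\<close>
  also have "sqrt (real n) * r = sqrt (\<Sum>k. w k * (A k)\<^sup>2) * z"
  proof -
    have "sqrt (real n) * r = sqrt (real n * \<alpha> * (\<Sum>k. s k * (A k)\<^sup>2)) * z"
      by (simp add: r_def real_sqrt_mult)
    also have "real n * \<alpha> * (\<Sum>k. s k * (A k)\<^sup>2) = (\<Sum>k. w k * (A k)\<^sup>2)"
      unfolding w \<kappa>_def[symmetric] using suminf_mult[OF sA2, of \<kappa>] by (simp add: mult.assoc)
    finally show ?thesis .
  qed
  finally show ?thesis by (simp add: A_def b_def F_def \<kappa>_def)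
qed

end

section \<open>Asymptotics of the bias\<close>

lemma powr_diff_mvt:
  fixes y e :: real
  assumes "y > 0"
  obtains \<xi> where "y < \<xi>" "\<xi> < y + 1" "(y + 1) powr e - y powr e = e * \<xi> powr (e - 1)"
proof -
  have "\<exists>\<xi>>y. \<xi> < y + 1 \<and> (y + 1) powr e - y powr e = (y + 1 - y) * (e * \<xi> powr (e - 1))"
  proof (rule MVT2)
    fix x assume "y \<le> x" "x \<le> y + 1"
    then show "((\<lambda>x. x powr e) has_real_derivative e * x powr (e - 1)) (at x)"
      using assms by (auto intro!: derivative_eq_intros has_real_derivative_powr)
  qed simp
  then show ?thesis using that by auto
qed

text \<open>For q \<le> 1 the summands do not increase and are compared with a telescoping sum, at
  the cost of 1/q; for q > 1 each is at most the power of K itself, at the cost of 1. The factor 1 +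
  1/q covers both cases.\<close>

lemma sum_powr_le:
  fixes q :: real
  assumes q: "0 < q"
  shows "(\<Sum>k<K. real (k + 1) powr (q - 1)) \<le> (1 + 1 / q) * real K powr q"
proof (cases "q \<le> 1")
  case True
  have "(\<Sum>k<K. real (k + 1) powr (q - 1)) \<le> real K powr q / q"
  proof (induction K)
    case (Suc K)
    have "real (K + 1) powr (q - 1) \<le> (real (Suc K) powr q - real K powr q) / q"
    \<comment> \<open>The mean value estimate needs a positive left end; the first summand is 1 and
      is covered by 1 \<le> 1/q.\<close>
    proof (cases "K = 0")
      case False
      then obtain \<xi> where \<xi>: "real K < \<xi>" "\<xi> < real K + 1"
          "(real K + 1) powr q - real K powr q = q * \<xi> powr (q - 1)"
        using powr_diff_mvt[of "real K" q] by auto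
      have "(real K + 1) powr (q - 1) \<le> \<xi> powr (q - 1)"
        using \<xi> True False by (intro powr_mono2') auto
      then show ?thesis using \<xi> q by (simp add: add.commute)
    qed (use True q in \<open>simp add: divide_simps\<close>)
    then show ?case using Suc by (simp add: diff_divide_distrib)
  qed (use q in simp)
  also have "\<dots> \<le> (1 + 1 / q) * real K powr q"
    by (simp add: algebra_simps)
  finally show ?thesis .
next
  case False
  have "(\<Sum>k<K. real (k + 1) powr (q - 1)) \<le> (\<Sum>k<K. real K powr (q - 1))"
    using False by (intro sum_mono powr_mono2) auto
  also have "\<dots> = real K powr q"
    using q by (cases "K = 0") (simp_all add: powr_mult_base)
  also have "\<dots> \<le> (1 + 1 / q) * real K powr q"
    using q by (simp add: algebra_simps)
  finally show ?thesis .
qed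

lemma summable_powr_Suc: "s > 0 \<Longrightarrow> summable (\<lambda>k. real (k + 1) powr (- 1 - s))"
  using summable_Suc_iff[of "\<lambda>k. real k powr (- 1 - s)"] by (simp add: summable_real_powr_iff)

lemma suminf_powr_tail_le:
  fixes s :: real
  assumes s: "s > 0" and K: "K \<ge> 1"
  shows "(\<Sum>k. real (k + K + 1) powr (- 1 - s)) \<le> real K powr (- s) / s"
proof (rule suminf_le_const)
  show "summable (\<lambda>k. real (k + K + 1) powr (- 1 - s))"
    using summable_powr_Suc[OF s] summable_iff_shift[of "\<lambda>k. real (k + 1) powr (- 1 - s)" K] by simp
  fix n
  have "(\<Sum>k<n. real (k + K + 1) powr (- 1 - s)) \<le> (real K powr (- s) - real (n + K) powr (- s)) / s"
  proof (induction n)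
    case (Suc n)
    obtain \<xi> where \<xi>: "real (n + K) < \<xi>" "\<xi> < real (n + K) + 1"
        "(real (n + K) + 1) powr (- s) - real (n + K) powr (- s) = - s * \<xi> powr (- s - 1)"
      using powr_diff_mvt[of "real (n + K)" "- s"] K by auto
    have "real (n + K + 1) powr (- 1 - s) \<le> \<xi> powr (- 1 - s)"
      using \<xi>(1,2) s K by (intro powr_mono2') auto
    also have "\<xi> powr (- 1 - s) = (real (n + K) powr (- s) - real (Suc n + K) powr (- s)) / s"
    proof -
      have "s * \<xi> powr (- 1 - s) = real (n + K) powr (- s) - real (Suc n + K) powr (- s)"
        using \<xi>(3) by (simp add: algebra_simps minus_diff_commute)
      then show ?thesis using s by (simp add: field_simps)
    qed
    finally show ?case using Suc by (simp add: diff_divide_distrib)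
  qed simp
  also have "\<dots> \<le> real K powr (- s) / s"
    using s by (intro divide_right_mono) auto
  finally show "(\<Sum>k<n. real (k + K + 1) powr (- 1 - s)) \<le> real K powr (- s) / s" .
qed

text \<open>With s = \<beta> + \<mu> and p = 1 + 2 \<gamma> this is f_k a_k / (1 + \<kappa>
  \<lambda>_k). The three regimes of the theorem are s > p, s = p and s < p.\<close>

definition bias_term :: "real \<Rightarrow> real \<Rightarrow> real \<Rightarrow> nat \<Rightarrow> real" where
  "bias_term s p \<kappa> k = real (k + 1) powr (- 1 - s) / (1 + \<kappa> * real (k + 1) powr (- p))"

definition bias :: "real \<Rightarrow> real \<Rightarrow> real \<Rightarrow> real" where
  "bias s p \<kappa> = (\<Sum>k. bias_term s p \<kappa> k)"

lemma bias_term_nonneg: "\<kappa> \<ge> 0 \<Longrightarrow> bias_term s p \<kappa> k \<ge> 0"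
  by (simp add: bias_term_def)

lemma bias_term_le: "\<kappa> \<ge> 0 \<Longrightarrow> bias_term s p \<kappa> k \<le> real (k + 1) powr (- 1 - s)"
proof -
  assume "\<kappa> \<ge> 0"
  then have "bias_term s p \<kappa> k \<le> real (k + 1) powr (- 1 - s) / 1"
    unfolding bias_term_def by (intro divide_left_mono mult_pos_pos) (auto intro: add_pos_nonneg)
  then show ?thesis by simp
qed

lemma bias_term_le': "\<kappa> > 0 \<Longrightarrow> bias_term s p \<kappa> k \<le> real (k + 1) powr (p - s - 1) / \<kappa>"
proof -
  assume \<kappa>: "\<kappa> > 0"
  have "bias_term s p \<kappa> k \<le> real (k + 1) powr (- 1 - s) / (\<kappa> * real (k + 1) powr (- p))"
    unfolding bias_term_def using \<kappa> by (intro divide_left_mono mult_pos_pos) (auto intro: add_pos_pos)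
  also have "\<dots> = real (k + 1) powr (- 1 - s - (- p)) / \<kappa>"
    unfolding powr_diff using \<kappa> by (simp add: field_simps)
  also have "- 1 - s - (- p) = p - s - 1" by simp
  finally show ?thesis .
qed

text \<open>The denominator is at most twice its larger summand. The larger one is the \<kappa> term
  here and the 1 in \<open>bias_term_ge_high\<close>, so each upper bound is sharp up to a factor 2
  on its side of the cutoff.\<close>

lemma bias_term_ge_low:
  assumes "\<kappa> > 0" "1 \<le> \<kappa> * real (k + 1) powr (- p)"
  shows "real (k + 1) powr (p - s - 1) / (2 * \<kappa>) \<le> bias_term s p \<kappa> k"
proof -
  have "real (k + 1) powr (- 1 - s) / (2 * (\<kappa> * real (k + 1) powr (- p))) \<le> bias_term s p \<kappa> k"
    unfolding bias_term_def using assms by (intro divide_left_mono mult_pos_pos) (auto intro: add_pos_pos)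
  also have "real (k + 1) powr (- 1 - s) / (2 * (\<kappa> * real (k + 1) powr (- p)))
      = real (k + 1) powr (- 1 - s - (- p)) / (2 * \<kappa>)"
    unfolding powr_diff using assms by (simp add: field_simps)
  also have "- 1 - s - (- p) = p - s - 1" by simp
  finally show ?thesis .
qed

lemma bias_term_ge_high:
  assumes "\<kappa> \<ge> 0" "\<kappa> * real (k + 1) powr (- p) \<le> 1"
  shows "real (k + 1) powr (- 1 - s) / 2 \<le> bias_term s p \<kappa> k"
  unfolding bias_term_def using assms
  by (intro divide_left_mono mult_pos_pos) (auto intro: add_pos_nonneg)

lemma summable_bias_term: "s > 0 \<Longrightarrow> \<kappa> \<ge> 0 \<Longrightarrow> summable (bias_term s p \<kappa>)"
  by (rule summable_comparison_test'[OF summable_powr_Suc, of s 0])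
    (auto simp: bias_term_nonneg bias_term_le[simplified])

lemma sum_bias_term_le: "s > 0 \<Longrightarrow> \<kappa> \<ge> 0 \<Longrightarrow> finite I \<Longrightarrow> sum (bias_term s p \<kappa>) I \<le> bias s p \<kappa>"
  unfolding bias_def by (intro sum_le_suminf summable_bias_term) (auto intro: bias_term_nonneg)

text \<open>The summands change regime where k exceeds the p-th root of \<open>\<kappa>\<close>.\<close>

definition cutoff :: "real \<Rightarrow> real \<Rightarrow> nat" where
  "cutoff p \<kappa> = nat \<lfloor>\<kappa> powr (1 / p)\<rfloor>"

lemma cutoff_bounds:
  assumes "p > 0" "\<kappa> \<ge> 1"
  shows "cutoff p \<kappa> \<ge> 1" "real (cutoff p \<kappa>) \<le> \<kappa> powr (1 / p)"
    "\<kappa> powr (1 / p) < real (cutoff p \<kappa>) + 1" "\<kappa> powr (1 / p) / 2 \<le> real (cutoff p \<kappa>)"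
proof -
  have x: "\<kappa> powr (1 / p) \<ge> 1" using assms by (simp add: ge_one_powr_ge_zero)
  then show a: "cutoff p \<kappa> \<ge> 1" unfolding cutoff_def by linarith
  show "real (cutoff p \<kappa>) \<le> \<kappa> powr (1 / p)" and b: "\<kappa> powr (1 / p) < real (cutoff p \<kappa>) + 1"
    using x unfolding cutoff_def by linarith+
  show "\<kappa> powr (1 / p) / 2 \<le> real (cutoff p \<kappa>)"
    using a b by simp
qed

text \<open>Each part uses the bound that is sharp there: below the cutoff the 1 in the denominator
  is discarded, above it the \<kappa> term.\<close>

lemma bias_le_cutoff:
  assumes s: "s > 0" and p: "p > 0" and \<kappa>: "\<kappa> \<ge> 1"
  shows "bias s p \<kappa> \<le> (\<Sum>k<cutoff p \<kappa>. real (k + 1) powr (p - s - 1)) / \<kappa>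
      + real (cutoff p \<kappa>) powr (- s) / s"
proof -
  let ?K = "cutoff p \<kappa>"
  have "bias s p \<kappa> = (\<Sum>k. bias_term s p \<kappa> (k + ?K)) + sum (bias_term s p \<kappa>) {..<?K}"
    unfolding bias_def using s \<kappa> by (intro suminf_split_initial_segment summable_bias_term) auto
  also have "(\<Sum>k. bias_term s p \<kappa> (k + ?K)) \<le> (\<Sum>k. real (k + ?K + 1) powr (- 1 - s))"
    using s \<kappa> summable_powr_Suc[OF s] summable_iff_shift[of "\<lambda>k. real (k + 1) powr (- 1 - s)" ?K]
      summable_bias_term[OF s, of \<kappa> p] summable_iff_shift[of "bias_term s p \<kappa>" ?K]
    by (intro suminf_le bias_term_le) auto
  also have "\<dots> \<le> real ?K powr (- s) / s"
    using s cutoff_bounds(1)[OF p \<kappa>] by (rule suminf_powr_tail_le)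
  also have "sum (bias_term s p \<kappa>) {..<?K} \<le> (\<Sum>k<?K. real (k + 1) powr (p - s - 1) / \<kappa>)"
    using \<kappa> by (intro sum_mono bias_term_le') auto
  finally show ?thesis by (simp add: sum_divide_distrib)
qed

lemma cutoff_powr_minus_le:
  assumes "s > 0" "p > 0" "\<kappa> \<ge> 1"
  shows "real (cutoff p \<kappa>) powr (- s) \<le> 2 powr s * \<kappa> powr (- s / p)"
proof -
  have "real (cutoff p \<kappa>) powr (- s) \<le> (\<kappa> powr (1 / p) / 2) powr (- s)"
    using cutoff_bounds(4)[OF assms(2,3)] assms by (intro powr_mono2') auto
  also have "\<dots> = 2 powr s * \<kappa> powr (- s / p)"
    using assms by (simp add: powr_divide powr_powr powr_minus field_simps)
  finally show ?thesis .
qed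

lemma bias_bounds_large:
  assumes "p > 0" "s > p"
  shows "\<exists>c C. 0 < c \<and> 0 < C \<and> (\<forall>\<kappa>\<ge>2. c * (1 / \<kappa>) \<le> bias s p \<kappa> \<and> bias s p \<kappa> \<le> C * (1 / \<kappa>))"
proof (intro exI conjI allI impI)
  let ?C = "\<Sum>k. real (k + 1) powr (p - s - 1)"
  have sum: "summable (\<lambda>k. real (k + 1) powr (p - s - 1))"
    using summable_powr_Suc[of "s - p"] assms by (simp add: algebra_simps)
  show "(0::real) < 1 / 2" by simp
  show "0 < ?C" by (intro suminf_pos sum) simp
  fix \<kappa> :: real assume \<kappa>: "\<kappa> \<ge> 2"
  have "sum (bias_term s p \<kappa>) {0} \<le> bias s p \<kappa>"
    using assms \<kappa> by (intro sum_bias_term_le) auto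
  moreover have "1 / 2 * (1 / \<kappa>) \<le> 1 / (1 + \<kappa>)" using \<kappa> by (simp add: field_simps)
  ultimately show "1 / 2 * (1 / \<kappa>) \<le> bias s p \<kappa>"
    by (simp add: bias_term_def)
  have "bias s p \<kappa> \<le> (\<Sum>k. real (k + 1) powr (p - s - 1) / \<kappa>)"
    unfolding bias_def using \<kappa> assms
    by (intro suminf_le bias_term_le' summable_bias_term summable_divide sum) auto
  also have "\<dots> = ?C * (1 / \<kappa>)" using suminf_divide[OF sum, of \<kappa>] by simp
  finally show "bias s p \<kappa> \<le> ?C * (1 / \<kappa>)" .
qed

text \<open>At s = p the terms below the cutoff are harmonic up to the factor 1 / \<kappa>, and the
  logarithm of the cutoff is about ln \<kappa> / p. The tail contributes only the order 1 /
  \<kappa>.\<close>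

lemma bias_bounds_critical:
  assumes p: "p > 0"
  shows "\<exists>c C. 0 < c \<and> 0 < C \<and>
    (\<forall>\<kappa>\<ge>2. c * (ln \<kappa> / \<kappa>) \<le> bias p p \<kappa> \<and> bias p p \<kappa> \<le> C * (ln \<kappa> / \<kappa>))"
proof (intro exI conjI allI impI)
  let ?C = "1 / p + (1 + 2 powr p / p) / ln 2"
  show "0 < 1 / (2 * p)" "0 < ?C" using p by (auto intro!: add_pos_nonneg)
  fix \<kappa> :: real assume \<kappa>: "\<kappa> \<ge> 2"
  let ?K = "cutoff p \<kappa>"
  have K: "?K \<ge> 1" "real ?K \<le> \<kappa> powr (1 / p)" "\<kappa> powr (1 / p) < real ?K + 1"
    using cutoff_bounds[of p \<kappa>] p \<kappa> by auto
  have harm: "(\<Sum>k<?K. real (k + 1) powr (p - p - 1)) = harm ?K"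
    by (simp add: harm_altdef powr_minus add.commute)
  have lnx: "ln (\<kappa> powr (1 / p)) = ln \<kappa> / p" using \<kappa> by (simp add: ln_powr)
  have "1 / (2 * p) * (ln \<kappa> / \<kappa>) = (ln \<kappa> / p) / (2 * \<kappa>)" by simp
  also have "\<dots> \<le> harm ?K / (2 * \<kappa>)"
  proof (rule divide_right_mono)
    have "ln (\<kappa> powr (1 / p)) \<le> ln (real ?K + 1)"
      using K \<kappa> by (subst ln_le_cancel_iff) auto
    also have "\<dots> \<le> harm ?K" by (rule ln_le_harm)
    finally show "ln \<kappa> / p \<le> harm ?K" by (simp add: lnx)
  qed (use \<kappa> in simp)
  also have "\<dots> = (\<Sum>k<?K. real (k + 1) powr (p - p - 1) / (2 * \<kappa>))"
    by (simp only: harm[symmetric] sum_divide_distrib)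
  also have "\<dots> \<le> sum (bias_term p p \<kappa>) {..<?K}"
  proof (intro sum_mono bias_term_ge_low)
    fix k assume "k \<in> {..<?K}"
    then have "real (k + 1) \<le> \<kappa> powr (1 / p)" using K(2) by auto
    then have "(\<kappa> powr (1 / p)) powr (- p) \<le> real (k + 1) powr (- p)"
      using p by (intro powr_mono2') auto
    then have "1 / \<kappa> \<le> real (k + 1) powr (- p)"
      using p \<kappa> by (simp add: powr_powr powr_minus_divide)
    then show "1 \<le> \<kappa> * real (k + 1) powr (- p)"
      using \<kappa> by (simp add: field_simps)
  qed (use \<kappa> in auto)
  also have "\<dots> \<le> bias p p \<kappa>"
    using p \<kappa> by (intro sum_bias_term_le) auto
  finally show "1 / (2 * p) * (ln \<kappa> / \<kappa>) \<le> bias p p \<kappa>" .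
  have "bias p p \<kappa> \<le> harm ?K / \<kappa> + real ?K powr (- p) / p"
    using bias_le_cutoff[of p p \<kappa>] p \<kappa> harm by simp
  also have "harm ?K \<le> ln (real ?K) + 1"
    using euler_mascheroni_sequence_decreasing[of 1 ?K] K by (simp add: harm_expand)
  also have "ln (real ?K) \<le> ln \<kappa> / p"
    unfolding lnx[symmetric] using K \<kappa> by (subst ln_le_cancel_iff) auto
  also have "real ?K powr (- p) \<le> 2 powr p * \<kappa> powr (- p / p)"
    using p \<kappa> by (intro cutoff_powr_minus_le) auto
  also have "\<kappa> powr (- p / p) = 1 / \<kappa>"
    using p \<kappa> by (simp add: powr_minus_divide)
  finally have "bias p p \<kappa> \<le> (ln \<kappa> / p + 1) / \<kappa> + 2 powr p * (1 / \<kappa>) / p"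
    using \<kappa> p by (simp add: divide_right_mono)
  also have "\<dots> = (1 / p * ln \<kappa> + (1 + 2 powr p / p) * 1) / \<kappa>"
    using p \<kappa> by (simp add: field_simps)
  \<comment> \<open>Constants are absorbed into the logarithm: \<kappa> \<ge> 2 gives 1 \<le> ln
    \<kappa> / ln 2.\<close>
  also have "\<dots> \<le> (1 / p * ln \<kappa> + (1 + 2 powr p / p) * (ln \<kappa> / ln 2)) / \<kappa>"
    using \<kappa> p by (intro divide_right_mono add_left_mono mult_left_mono) auto
  also have "\<dots> = ?C * (ln \<kappa> / \<kappa>)"
    by (simp add: algebra_simps add_divide_distrib)
  finally show "bias p p \<kappa> \<le> ?C * (ln \<kappa> / \<kappa>)" .
qed

text \<open>Head and tail now have the same order. The lower bound uses the block from the cutoff K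
  to 2K: it has K terms, each at least (2K)^(-1-s) / 2, whence the constant 2^(-2-s).\<close>

lemma bias_bounds_small:
  assumes s: "s > 0" and p: "s < p"
  shows "\<exists>c C. 0 < c \<and> 0 < C \<and>
    (\<forall>\<kappa>\<ge>2. c * \<kappa> powr (- s / p) \<le> bias s p \<kappa> \<and> bias s p \<kappa> \<le> C * \<kappa> powr (- s / p))"
proof (intro exI conjI allI impI)
  let ?C = "1 + 1 / (p - s) + 2 powr s / s"
  show "0 < 2 powr (- 2 - s)" "0 < ?C" using s p by (auto intro!: add_pos_pos)
  fix \<kappa> :: real assume \<kappa>: "\<kappa> \<ge> 2"
  let ?K = "cutoff p \<kappa>"
  have p0: "p > 0" using s p by simp
  have K: "?K \<ge> 1" "real ?K \<le> \<kappa> powr (1 / p)" "\<kappa> powr (1 / p) < real ?K + 1"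
    using cutoff_bounds[of p \<kappa>] p0 \<kappa> by auto
  have "2 powr (- 2 - s) * \<kappa> powr (- s / p) = 2 powr (- 2 - s) * (\<kappa> powr (1 / p)) powr (- s)"
    by (simp add: powr_powr)
  also have "\<dots> \<le> 2 powr (- 2 - s) * real ?K powr (- s)"
    using K s by (intro mult_left_mono powr_mono2') auto
  also have "\<dots> = real ?K * ((2 * real ?K) powr (- 1 - s) / 2)"
  proof -
    have split: "(2 * real ?K) powr (- 1 - s) = 2 powr (- 1 - s) * real ?K powr (- 1 - s)"
      by (simp add: powr_mult)
    have absorb: "real ?K powr (- s) = real ?K * real ?K powr (- 1 - s)"
      using K(1) by (simp add: powr_mult_base)
    have "2 powr (- 1 - s) = 2 powr (- 2 - s + 1)"
      by (rule arg_cong[where f="\<lambda>x. 2 powr x"]) simp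
    also have "\<dots> = 2 powr (- 2 - s) * 2"
      by (subst powr_add) simp
    finally have halve: "2 powr (- 1 - s) = 2 powr (- 2 - s) * (2::real)" .
    show ?thesis unfolding split absorb halve by simp
  qed
  also have "\<dots> = (\<Sum>k\<in>{?K..<2 * ?K}. (2 * real ?K) powr (- 1 - s) / 2)" by simp
  also have "\<dots> \<le> sum (bias_term s p \<kappa>) {?K..<2 * ?K}"
  proof (rule sum_mono)
    fix k assume k: "k \<in> {?K..<2 * ?K}"
    have "(2 * real ?K) powr (- 1 - s) / 2 \<le> real (k + 1) powr (- 1 - s) / 2"
      using k s by (intro divide_right_mono powr_mono2') auto
    also have "\<dots> \<le> bias_term s p \<kappa> k"
    proof (rule bias_term_ge_high)
      \<comment> \<open>Position k stands for the number k + 1, so k \<ge> K already puts it beyond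
        the real cutoff that K rounds down.\<close>
      have "\<kappa> powr (1 / p) \<le> real (k + 1)" using k K(3) by auto
      then have "real (k + 1) powr (- p) \<le> (\<kappa> powr (1 / p)) powr (- p)"
        using p0 \<kappa> by (intro powr_mono2') auto
      also have "\<dots> = 1 / \<kappa>" using p0 \<kappa> by (simp add: powr_powr powr_minus_divide)
      finally show "\<kappa> * real (k + 1) powr (- p) \<le> 1"
        using \<kappa> by (simp add: field_simps)
    qed (use \<kappa> in simp)
    finally show "(2 * real ?K) powr (- 1 - s) / 2 \<le> bias_term s p \<kappa> k" .
  qed
  also have "\<dots> \<le> bias s p \<kappa>"
    using s \<kappa> by (intro sum_bias_term_le) auto
  finally show "2 powr (- 2 - s) * \<kappa> powr (- s / p) \<le> bias s p \<kappa>" .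
  have "bias s p \<kappa> \<le> (\<Sum>k<?K. real (k + 1) powr (p - s - 1)) / \<kappa> + real ?K powr (- s) / s"
    using s p0 \<kappa> by (intro bias_le_cutoff) auto
  also have "(\<Sum>k<?K. real (k + 1) powr (p - s - 1)) \<le> (1 + 1 / (p - s)) * real ?K powr (p - s)"
    using p by (intro sum_powr_le) simp
  also have "real ?K powr (p - s) \<le> (\<kappa> powr (1 / p)) powr (p - s)"
    using K p by (intro powr_mono2) auto
  also have "(\<kappa> powr (1 / p)) powr (p - s) = \<kappa> * \<kappa> powr (- s / p)"
    using p0 \<kappa> by (simp add: powr_powr powr_mult_base diff_divide_distrib)
  also have "real ?K powr (- s) \<le> 2 powr s * \<kappa> powr (- s / p)"
    using s p0 \<kappa> by (intro cutoff_powr_minus_le) auto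
  finally have "bias s p \<kappa> \<le> (1 + 1 / (p - s)) * (\<kappa> * \<kappa> powr (- s / p)) / \<kappa>
      + 2 powr s * \<kappa> powr (- s / p) / s"
    using s p \<kappa> by (simp add: divide_right_mono mult_left_mono)
  also have "\<dots> = ?C * \<kappa> powr (- s / p)"
    using s p \<kappa> by (simp add: field_simps)
  finally show "bias s p \<kappa> \<le> ?C * \<kappa> powr (- s / p)" .
qed

section \<open>Efficiency\<close>

lemma tendsto_zero_iff_two_sided:
  fixes u v :: "'a \<Rightarrow> real"
  assumes "c > 0" and bounds: "eventually (\<lambda>x. 0 \<le> u x \<and> c * u x \<le> v x \<and> v x \<le> C * u x) F"
  shows "(v \<longlongrightarrow> 0) F \<longleftrightarrow> (u \<longlongrightarrow> 0) F"
proof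
  assume "(u \<longlongrightarrow> 0) F"
  then have lim: "((\<lambda>x. C * u x) \<longlongrightarrow> 0) F" by (rule tendsto_mult_right_zero)
  have le: "eventually (\<lambda>x. v x \<le> C * u x) F"
    using bounds by (rule eventually_mono) simp
  have "eventually (\<lambda>x. 0 \<le> v x) F"
    using bounds
  proof eventually_elim
    case (elim x)
    moreover have "0 \<le> c * u x" using elim assms(1) by simp
    ultimately show ?case by linarith
  qed
  then show "(v \<longlongrightarrow> 0) F"
    using le by (rule tendsto_sandwich[OF _ _ tendsto_const lim])
next
  assume "(v \<longlongrightarrow> 0) F"
  then have lim: "((\<lambda>x. v x / c) \<longlongrightarrow> 0) F" by (rule tendsto_divide_zero)
  have nonneg: "eventually (\<lambda>x. 0 \<le> u x) F"
    using bounds by (rule eventually_mono) simp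
  have "eventually (\<lambda>x. u x \<le> v x / c) F"
    using bounds by (rule eventually_mono) (use assms(1) in \<open>simp add: field_simps\<close>)
  with nonneg show "(u \<longlongrightarrow> 0) F"
    by (rule tendsto_sandwich[OF _ _ tendsto_const lim])
qed

text \<open>Tannery's theorem with majorant c: the weights lie in [0, 1] and each tends to 1. The
  power j = 1 serves the width of the corrected interval, j = 2 the sampling variance of the
  posterior mean.\<close>

lemma weighted_suminf_tendsto:
  fixes c lam :: "nat \<Rightarrow> real"
  assumes lam: "\<And>k. lam k > 0" and c: "\<And>k. c k \<ge> 0" "summable c"
    and \<kappa>: "\<And>n. \<kappa> n \<ge> 0" "filterlim \<kappa> at_top sequentially"
  shows "(\<lambda>n. \<Sum>k. (\<kappa> n * lam k / (1 + \<kappa> n * lam k)) ^ j * c k) \<longlonglongrightarrow> (\<Sum>k. c k)"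
proof -
  have w: "\<bar>\<kappa> n * lam k / (1 + \<kappa> n * lam k)\<bar> \<le> 1" for n k
  proof -
    have "0 \<le> \<kappa> n * lam k" using \<kappa>(1)[of n] lam[of k] by simp
    then show ?thesis by (simp add: abs_mult divide_le_eq)
  qed
  have "eventually (\<lambda>(k, n). norm ((\<kappa> n * lam k / (1 + \<kappa> n * lam k)) ^ j * c k) \<le> c k)
      (at_top \<times>\<^sub>F sequentially)"
  proof (intro always_eventually allI, clarify)
    fix k n
    show "norm ((\<kappa> n * lam k / (1 + \<kappa> n * lam k)) ^ j * c k) \<le> c k"
    proof -
      have "\<bar>\<kappa> n * lam k / (1 + \<kappa> n * lam k)\<bar> ^ j * \<bar>c k\<bar> \<le> 1 * c k"
        using c(1)[of k] by (intro mult_mono power_le_one w) auto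
      then show ?thesis by (simp only: real_norm_def abs_mult power_abs mult_1)
    qed
  qed
  moreover have "(\<lambda>n. (\<kappa> n * lam k / (1 + \<kappa> n * lam k)) ^ j * c k) \<longlonglongrightarrow> 1 ^ j * c k" for k
  proof (intro tendsto_intros)
    have "filterlim (\<lambda>n. 1 + lam k * \<kappa> n) at_top sequentially"
      using lam[of k] \<kappa>(2)
      by (intro filterlim_tendsto_add_at_top[OF tendsto_const]
          filterlim_tendsto_pos_mult_at_top[OF tendsto_const])
    then have "(\<lambda>n. 1 - inverse (1 + lam k * \<kappa> n)) \<longlonglongrightarrow> 1 - 0"
      by (intro tendsto_intros tendsto_inverse_0_at_top)
    moreover have "1 - inverse (1 + lam k * \<kappa> n) = \<kappa> n * lam k / (1 + \<kappa> n * lam k)" for n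
      using \<kappa>(1)[of n] lam[of k] add_pos_nonneg[of 1 "lam k * \<kappa> n"] by (simp add: field_simps)
    ultimately show "(\<lambda>n. \<kappa> n * lam k / (1 + \<kappa> n * lam k)) \<longlonglongrightarrow> 1" by simp
  qed
  ultimately show ?thesis
    using tannerys_theorem[of "\<lambda>k n. (\<kappa> n * lam k / (1 + \<kappa> n * lam k)) ^ j * c k" c sequentially c] c(2)
    by simp
qed

text \<open>Division by zero being 0, this holds for all n and x, so the rates can be rewritten
  without restriction to large n.\<close>

lemma sqrt_mult_divide_self: "sqrt (real n) * (y / (real n * x)) = y / (sqrt (real n) * x)"
proof -
  have "sqrt (real n) * (y / (real n * x)) = sqrt (real n) / real n * (y / x)" by simp
  also have "\<dots> = inverse (sqrt (real n)) * (y / x)" by (simp add: sqrt_divide_self_eq)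
  finally show ?thesis by (simp add: divide_inverse)
qed

section \<open>Orders of the bias as conditions on \<open>\<alpha>\<close>\<close>

context
  fixes \<alpha> :: "nat \<Rightarrow> real"
  assumes alpha: "\<And>n. n \<ge> 1 \<Longrightarrow> 0 < \<alpha> n \<and> \<alpha> n \<le> 1"
    and n_alpha: "filterlim (\<lambda>n. real n * \<alpha> n) at_top sequentially"
begin

text \<open>The 3 exceeds e, which gives ln (n \<alpha>) \<ge> 1, and also the 2 from which the bias
  bounds are valid.\<close>

lemma eventually_n_alpha: "eventually (\<lambda>n. n \<ge> 2 \<and> real n * \<alpha> n \<ge> 3) sequentially"
  using n_alpha eventually_ge_at_top[of 2]
  by (auto simp: filterlim_at_top eventually_conj_iff)

lemma eventually_alpha_pos: "eventually (\<lambda>n. n \<ge> 2 \<and> 0 < \<alpha> n) sequentially"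
  using eventually_ge_at_top[of 2] by (rule eventually_mono) (use alpha in auto)

lemma rate_large:
  "(\<lambda>n. sqrt (real n) * (1 / (real n * \<alpha> n))) \<longlonglongrightarrow> 0
    \<longleftrightarrow> filterlim (\<lambda>n. sqrt (real n) * \<alpha> n) at_top sequentially"
proof -
  have "eventually (\<lambda>n. 0 < sqrt (real n) * \<alpha> n) sequentially"
    using eventually_alpha_pos by (rule eventually_mono) simp
  note filterlim_at_top_iff_inverse_0[OF this]
  also have "(inverse \<circ> (\<lambda>n. sqrt (real n) * \<alpha> n)) = (\<lambda>n. sqrt (real n) * (1 / (real n * \<alpha> n)))"
    unfolding sqrt_mult_divide_self by (simp add: fun_eq_iff inverse_eq_divide)
  finally show ?thesis by simp
qed

text \<open>The bias contains ln (n \<alpha>), the criterion ln n. One comparison is immediate from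
  \<alpha> \<le> 1; the reverse one, up to a factor 2, is available only once the rate is known to
  be small.\<close>

lemma rate_critical:
  "(\<lambda>n. sqrt (real n) * (ln (real n * \<alpha> n) / (real n * \<alpha> n))) \<longlonglongrightarrow> 0
    \<longleftrightarrow> filterlim (\<lambda>n. sqrt (real n) / ln (real n) * \<alpha> n) at_top sequentially"
    (is "?u \<longlonglongrightarrow> 0 \<longleftrightarrow> _")
proof -
  let ?v = "\<lambda>n. ln (real n) / (sqrt (real n) * \<alpha> n)"
  have "eventually (\<lambda>n. 0 < sqrt (real n) / ln (real n) * \<alpha> n) sequentially"
    using eventually_alpha_pos by (rule eventually_mono) simp
  note filterlim_at_top_iff_inverse_0[OF this]
  also have "(inverse \<circ> (\<lambda>n. sqrt (real n) / ln (real n) * \<alpha> n)) = ?v"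
    by (auto simp: field_simps)
  also have "?v \<longlonglongrightarrow> 0 \<longleftrightarrow> ?u \<longlonglongrightarrow> 0"
  proof -
    have u: "?u n = ln (real n * \<alpha> n) / (sqrt (real n) * \<alpha> n)" for n
      by (rule sqrt_mult_divide_self)
    have ev: "eventually (\<lambda>n. 0 \<le> ?u n \<and> ?u n \<le> ?v n) sequentially"
      using eventually_n_alpha
    proof eventually_elim
      case (elim n)
      then have \<alpha>: "0 < \<alpha> n" "\<alpha> n \<le> 1" using alpha[of n] by auto
      have "real n * \<alpha> n \<le> real n" using \<alpha> by (simp add: mult_left_le)
      then have "0 \<le> ln (real n * \<alpha> n)" "ln (real n * \<alpha> n) \<le> ln (real n)"
        using elim by (auto intro: ln_ge_zero)
      then show ?case unfolding u using \<alpha> by (auto intro: divide_right_mono)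
    qed
    show ?thesis
    proof
      assume v: "?v \<longlonglongrightarrow> 0"
      show "?u \<longlonglongrightarrow> 0"
        by (rule tendsto_sandwich[OF _ _ tendsto_const v]; rule eventually_mono[OF ev]; simp)
    next
      assume lim: "?u \<longlonglongrightarrow> 0"
      \<comment> \<open>A bootstrap: \<open>?u n < 1\<close> and ln (n \<alpha>) \<ge> 1 force sqrt
        n * \<alpha> \<ge> 1, that is n \<alpha> \<ge> sqrt n, and therefore ln n \<le> 2 ln (n
        \<alpha>).\<close>
      have "eventually (\<lambda>n. ?u n < 1) sequentially"
        using lim by (rule order_tendstoD) simp
      then have "eventually (\<lambda>n. 0 \<le> ?v n \<and> ?v n \<le> 2 * ?u n) sequentially"
        using eventually_n_alpha
      proof eventually_elim
        case (elim n)
        then have \<alpha>: "0 < \<alpha> n" "\<alpha> n \<le> 1" using alpha[of n] by auto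
        have pos: "sqrt (real n) * \<alpha> n > 0" using \<alpha> elim by simp
        have "exp 1 \<le> real n * \<alpha> n" using elim exp_le by linarith
        then have "1 \<le> ln (real n * \<alpha> n)"
          using elim by (subst ln_ge_iff) auto
        also have "ln (real n * \<alpha> n) < sqrt (real n) * \<alpha> n"
          using elim(1) pos unfolding u by (simp add: divide_less_eq)
        finally have "1 \<le> sqrt (real n) * \<alpha> n" by simp
        then have "sqrt (real n) * 1 \<le> sqrt (real n) * (sqrt (real n) * \<alpha> n)"
          by (intro mult_left_mono) auto
        then have "sqrt (real n) \<le> real n * \<alpha> n"
          by (simp add: mult.assoc[symmetric])
        then have "ln (sqrt (real n)) \<le> ln (real n * \<alpha> n)"
          using elim by (subst ln_le_cancel_iff) auto
        then have "ln (real n) \<le> 2 * ln (real n * \<alpha> n)"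
          using elim by (simp add: ln_sqrt)
        then have "?v n \<le> 2 * ln (real n * \<alpha> n) / (sqrt (real n) * \<alpha> n)"
          using pos by (intro divide_right_mono) auto
        then show ?case unfolding u using pos elim by simp
      qed
      then have "eventually (\<lambda>n. 0 \<le> ?v n) sequentially" "eventually (\<lambda>n. ?v n \<le> 2 * ?u n) sequentially"
        by (auto elim: eventually_mono)
      then show "?v \<longlonglongrightarrow> 0"
        by (rule tendsto_sandwich[OF _ _ tendsto_const tendsto_mult_right_zero[OF lim]])
    qed
  qed
  finally show ?thesis by simp
qed

text \<open>The two sequences are powers of each other: (1 - p / (2s)) (- s/p) = 1/2 - s/p, so the
  first is the second raised to - s/p. This explains the exponent in the criterion.\<close>

lemma rate_small:
  assumes s: "s > 0" and p: "p > 0"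
  shows "(\<lambda>n. sqrt (real n) * (real n * \<alpha> n) powr (- s / p)) \<longlonglongrightarrow> 0
    \<longleftrightarrow> filterlim (\<lambda>n. real n powr (1 - p / (2 * s)) * \<alpha> n) at_top sequentially"
    (is "?u \<longlonglongrightarrow> 0 \<longleftrightarrow> filterlim ?x at_top sequentially")
proof -
  have pos: "eventually (\<lambda>n. 0 < ?x n) sequentially"
    using eventually_alpha_pos by (rule eventually_mono) simp
  have eq: "eventually (\<lambda>n. ?u n = ?x n powr (- (s / p)) \<and> inverse (?x n) = ?u n powr (p / s)) sequentially"
    using eventually_alpha_pos
  proof eventually_elim
    case (elim n)
    have "(1 - p / (2 * s)) * (- (s / p)) = 1 / 2 + - (s / p)"
      using s p by (simp add: field_simps)
    then have "?x n powr (- (s / p)) = real n powr (1 / 2 + - (s / p)) * \<alpha> n powr (- (s / p))"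
      using elim by (simp add: powr_mult powr_powr)
    also have "\<dots> = ?u n"
      using elim unfolding powr_add by (simp add: powr_half_sqrt powr_mult)
    finally have u: "?u n = ?x n powr (- (s / p))" ..
    moreover have "?u n powr (p / s) = inverse (?x n)"
    proof -
      have "?u n powr (p / s) = ?x n powr (- (s / p) * (p / s))" unfolding u by (rule powr_powr)
      also have "- (s / p) * (p / s) = - 1" using s p by simp
      also have "?x n powr (- 1) = inverse (?x n)"
        using elim by (subst powr_minus, subst powr_one) auto
      finally show ?thesis .
    qed
    ultimately show ?case by simp
  qed
  show ?thesis
  proof
    assume x: "filterlim ?x at_top sequentially"
    have "(\<lambda>n. ?x n powr (- (s / p))) \<longlonglongrightarrow> 0"
      using s p by (intro tendsto_neg_powr x) simp
    then show "?u \<longlonglongrightarrow> 0"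
      by (rule Lim_transform_eventually) (use eq in \<open>auto elim: eventually_mono\<close>)
  next
    assume u: "?u \<longlonglongrightarrow> 0"
    have "(\<lambda>n. ?u n powr (p / s)) \<longlonglongrightarrow> 0 powr (p / s)"
      using s p by (intro tendsto_powr' u tendsto_const) (auto simp: eventually_sequentially)
    then have "(\<lambda>n. ?u n powr (p / s)) \<longlonglongrightarrow> 0" by simp
    then have "(inverse \<circ> ?x) \<longlonglongrightarrow> 0"
      by (rule Lim_transform_eventually) (use eq in \<open>auto elim: eventually_mono\<close>)
    then show "filterlim ?x at_top sequentially"
      by (simp only: filterlim_at_top_iff_inverse_0[OF pos])
  qed
qed

lemma sqrt_bias_tendsto_iff:
  assumes "\<exists>c C. 0 < c \<and> 0 < C \<and> (\<forall>\<kappa>\<ge>2. c * g \<kappa> \<le> bias s p \<kappa> \<and> bias s p \<kappa> \<le> C * g \<kappa>)"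
    and g: "\<And>\<kappa>. \<kappa> \<ge> 2 \<Longrightarrow> g \<kappa> \<ge> 0"
  shows "(\<lambda>n. sqrt (real n) * bias s p (real n * \<alpha> n)) \<longlonglongrightarrow> 0
    \<longleftrightarrow> (\<lambda>n. sqrt (real n) * g (real n * \<alpha> n)) \<longlonglongrightarrow> 0"
proof -
  obtain c C where c: "c > 0" and
    bounds: "\<forall>\<kappa>\<ge>2. c * g \<kappa> \<le> bias s p \<kappa> \<and> bias s p \<kappa> \<le> C * g \<kappa>"
    using assms(1) by blast
  show ?thesis
  proof (rule tendsto_zero_iff_two_sided[OF c])
    show "eventually (\<lambda>n. 0 \<le> sqrt (real n) * g (real n * \<alpha> n)
      \<and> c * (sqrt (real n) * g (real n * \<alpha> n)) \<le> sqrt (real n) * bias s p (real n * \<alpha> n)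
      \<and> sqrt (real n) * bias s p (real n * \<alpha> n) \<le> C * (sqrt (real n) * g (real n * \<alpha> n))) sequentially"
      using eventually_n_alpha
    proof eventually_elim
      case (elim n)
      then have \<kappa>: "real n * \<alpha> n \<ge> 2" by simp
      have "sqrt (real n) * (c * g (real n * \<alpha> n)) \<le> sqrt (real n) * bias s p (real n * \<alpha> n)"
        "sqrt (real n) * bias s p (real n * \<alpha> n) \<le> sqrt (real n) * (C * g (real n * \<alpha> n))"
        using bounds \<kappa> by (auto intro!: mult_left_mono)
      then show ?case using g[OF \<kappa>] by (simp add: mult.left_commute)
    qed
  qed
qed

end

theorem proposition3p2:
  fixes \<phi> :: "nat \<Rightarrow> real \<Rightarrow> real"
    and a f0 :: "real \<Rightarrow> real"
    and prior :: "(real \<Rightarrow> real) measure"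
    and \<alpha> :: "nat \<Rightarrow> real"
    and \<beta> \<mu> \<gamma> \<delta> :: real
  assumes basis: "orthonormal_basis_L2 \<phi>"
    and pos: "\<beta> > 0" "\<mu> > 0" "\<gamma> > 0"
    and f0: "f0 \<in> L2" "\<And>k. coef \<phi> f0 k = real (k + 1) powr (- 1 / 2 - \<beta>)"
    and a: "a \<in> L2" "\<And>k. coef \<phi> a k = real (k + 1) powr (- 1 / 2 - \<mu>)"
    and gaussian: "gaussian_series_prior \<phi> (\<lambda>k. real (k + 1) powr (- 1 - 2 * \<gamma>)) prior"
    and alpha: "\<And>n. n \<ge> 1 \<Longrightarrow> 0 < \<alpha> n \<and> \<alpha> n \<le> 1"
    and n_alpha: "filterlim (\<lambda>n. real n * \<alpha> n) at_top sequentially"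
    and delta: "0 < \<delta>" "\<delta> < 1"
  shows "(\<beta> + \<mu> > 1 + 2 * \<gamma> \<longrightarrow>
            (efficient_intervals prior \<phi> a f0 \<alpha> \<delta> \<longleftrightarrow>
             filterlim (\<lambda>n. sqrt (real n) * \<alpha> n) at_top sequentially)) \<and>
         (\<beta> + \<mu> = 1 + 2 * \<gamma> \<longrightarrow>
            (efficient_intervals prior \<phi> a f0 \<alpha> \<delta> \<longleftrightarrow>
             filterlim (\<lambda>n. sqrt (real n) / ln (real n) * \<alpha> n) at_top sequentially)) \<and>
         (1 / 2 + \<gamma> < \<beta> + \<mu> \<and> \<beta> + \<mu> < 1 + 2 * \<gamma> \<longrightarrow>
            (efficient_intervals prior \<phi> a f0 \<alpha> \<delta> \<longleftrightarrow>
             filterlim (\<lambda>n. real n powr (1 - (1 + 2 * \<gamma>) / (2 * (\<beta> + \<mu>))) * \<alpha> n)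
               at_top sequentially))"
proof -
  define lam where "lam k = real (k + 1) powr (- 1 - 2 * \<gamma>)" for k
  define s where "s = \<beta> + \<mu>"
  define p where "p = 1 + 2 * \<gamma>"
  have s: "s > 0" and p: "p > 0" using pos by (simp_all add: s_def p_def)
  have lam_pos: "lam k > 0" for k by (simp add: lam_def)
  note coef_a = a(2)
  have a_pos: "coef \<phi> a k > 0" for k by (simp add: coef_a)
  interpret white_noise_model \<phi> lam prior a
  proof
    show "gaussian_series_prior \<phi> lam prior" using gaussian by (simp add: lam_def[abs_def])
    show "summable lam" unfolding lam_def[abs_def] using pos by (intro summable_powr_Suc) simp
  qed (use basis a lam_pos a_pos in auto)
  obtain z where z: "Phi z = 1 - \<delta> / 2" using Phi_eq_ex[of "1 - \<delta> / 2"] delta by auto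
  have "Phi 0 = 1 / 2" using Phi_minus[of 0] by simp
  then have z_pos: "z > 0" using z delta Phi_less_iff[of 0 z] by simp
  have level: "coverage z 0 = 1 - \<delta>" using z by (simp add: coverage_def Phi_minus)
  define \<kappa> where "\<kappa> n = real n * \<alpha> n" for n
  \<comment> \<open>\<open>\<alpha> 0\<close> is arbitrary, but \<kappa> 0 = 0 whatever its
    value.\<close>
  have \<kappa>: "\<kappa> n \<ge> 0" for n using alpha[of n] by (cases "n = 0") (auto simp: \<kappa>_def)
  have \<kappa>_lim: "filterlim \<kappa> at_top sequentially" using n_alpha by (simp add: \<kappa>_def[abs_def])
  define w where "w n k = \<kappa> n * lam k / (1 + \<kappa> n * lam k)" for n k
  define \<tau> where "\<tau> n = sqrt (\<Sum>k. (w n k * coef \<phi> a k)\<^sup>2)" for n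
  define \<sigma> where "\<sigma> n = sqrt (\<Sum>k. w n k * (coef \<phi> a k)\<^sup>2)" for n
  define \<tau>\<^sub>0 where "\<tau>\<^sub>0 = sqrt (\<Sum>k. (coef \<phi> a k)\<^sup>2)"
  have "(\<Sum>k. (coef \<phi> a k)\<^sup>2) > 0"
    using a_pos by (intro suminf_pos summable_coef_a_square) (simp add: less_imp_neq[symmetric])
  then have \<tau>0: "\<tau>\<^sub>0 > 0" by (simp add: \<tau>\<^sub>0_def)
  have "(\<lambda>n. \<Sum>k. w n k ^ j * (coef \<phi> a k)\<^sup>2) \<longlonglongrightarrow> (\<Sum>k. (coef \<phi> a k)\<^sup>2)" for j
    unfolding w_def
    by (intro weighted_suminf_tendsto lam_pos summable_coef_a_square \<kappa> \<kappa>_lim) auto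
  from tendsto_real_sqrt[OF this[of 2]] tendsto_real_sqrt[OF this[of 1]]
  have \<tau>_lim: "\<tau> \<longlonglongrightarrow> \<tau>\<^sub>0" and \<sigma>_lim: "\<sigma> \<longlonglongrightarrow> \<tau>\<^sub>0"
    by (simp_all add: \<tau>_def[abs_def] \<sigma>_def[abs_def] \<tau>\<^sub>0_def power_mult_distrib)
  have \<rho>_lim: "(\<lambda>n. \<sigma> n / \<tau> n) \<longlonglongrightarrow> 1"
    using tendsto_divide[OF \<sigma>_lim \<tau>_lim] \<tau>0 by simp
  have bias_eq: "(\<Sum>k. coef \<phi> f0 k * coef \<phi> a k / (1 + \<kappa> n * lam k)) = bias s p (\<kappa> n)" for n
  proof -
    have "coef \<phi> f0 k * coef \<phi> a k = real (k + 1) powr (- 1 - s)" for k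
      unfolding f0(2) coef_a powr_add[symmetric] by (simp add: s_def algebra_simps)
    then show ?thesis by (simp add: bias_def bias_term_def lam_def p_def)
  qed
  define B where "B n = sqrt (real n) * bias s p (\<kappa> n) / \<tau> n" for n
  have \<tau>_pos: "eventually (\<lambda>n. \<tau> n > 0) sequentially"
    using \<tau>_lim \<tau>0 by (rule order_tendstoD)
  \<comment> \<open>All terms have the same sign, so the standardised bias stays on the half-line
    where the coverage is monotone.\<close>
  have "bias s p (\<kappa> n) \<ge> 0" for n
    unfolding bias_def using s \<kappa> by (intro suminf_nonneg summable_bias_term bias_term_nonneg)
  then have B_nonneg: "eventually (\<lambda>n. B n \<ge> 0) sequentially"
    using \<tau>_pos by (auto simp: B_def elim!: eventually_mono)
  have "eventually (\<lambda>n. measure (white_noise_law \<phi> n f0) {Y \<in> space (white_noise_law \<phi> n f0).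
      linear_functional a f0 \<in> corrected_interval (\<alpha> n) \<delta> (functional_posterior prior \<phi> a (\<alpha> n) n Y)}
    = coverage (\<sigma> n / \<tau> n * z) (B n)) sequentially"
    using eventually_ge_at_top[of 1]
  proof eventually_elim
    case (elim n)
    show ?case
      unfolding B_def bias_eq[symmetric] \<sigma>_def \<tau>_def w_def unfolding \<kappa>_def
      by (rule coverage_probability[OF f0(1) elim _ delta z z_pos]) (use alpha[OF elim] in simp)
  qed
  then have "efficient_intervals prior \<phi> a f0 \<alpha> \<delta>
      \<longleftrightarrow> (\<lambda>n. coverage (\<sigma> n / \<tau> n * z) (B n)) \<longlonglongrightarrow> 1 - \<delta>"
    unfolding efficient_intervals_def by (rule tendsto_cong)
  also have "\<dots> \<longleftrightarrow> B \<longlonglongrightarrow> 0"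
    using coverage_tendsto_iff[OF z_pos B_nonneg \<rho>_lim] unfolding level .
  also have "\<dots> \<longleftrightarrow> (\<lambda>n. sqrt (real n) * bias s p (\<kappa> n)) \<longlonglongrightarrow> 0"
  proof
    assume "B \<longlonglongrightarrow> 0"
    then have "(\<lambda>n. B n * \<tau> n) \<longlonglongrightarrow> 0 * \<tau>\<^sub>0" by (intro tendsto_mult \<tau>_lim)
    moreover have "eventually (\<lambda>n. B n * \<tau> n = sqrt (real n) * bias s p (\<kappa> n)) sequentially"
      using \<tau>_pos by (rule eventually_mono) (simp add: B_def)
    ultimately show "(\<lambda>n. sqrt (real n) * bias s p (\<kappa> n)) \<longlonglongrightarrow> 0"
      by (simp add: tendsto_cong)
  next
    assume "(\<lambda>n. sqrt (real n) * bias s p (\<kappa> n)) \<longlonglongrightarrow> 0"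
    then have "B \<longlonglongrightarrow> 0 / \<tau>\<^sub>0"
      unfolding B_def using \<tau>0 by (intro tendsto_divide \<tau>_lim) auto
    then show "B \<longlonglongrightarrow> 0" by simp
  qed
  finally have eff: "efficient_intervals prior \<phi> a f0 \<alpha> \<delta>
      \<longleftrightarrow> (\<lambda>n. sqrt (real n) * bias s p (real n * \<alpha> n)) \<longlonglongrightarrow> 0"
    by (simp add: \<kappa>_def)
  show ?thesis
    unfolding s_def[symmetric] p_def[symmetric] eff
  proof (intro conjI impI)
    assume "p < s"
    then show "(\<lambda>n. sqrt (real n) * bias s p (real n * \<alpha> n)) \<longlonglongrightarrow> 0
        \<longleftrightarrow> filterlim (\<lambda>n. sqrt (real n) * \<alpha> n) at_top sequentially"
      using sqrt_bias_tendsto_iff[OF alpha n_alpha bias_bounds_large[OF p]]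
      by (simp only: rate_large[OF alpha n_alpha]) simp
  next
    assume "s = p"
    then show "(\<lambda>n. sqrt (real n) * bias s p (real n * \<alpha> n)) \<longlonglongrightarrow> 0
        \<longleftrightarrow> filterlim (\<lambda>n. sqrt (real n) / ln (real n) * \<alpha> n) at_top sequentially"
      using sqrt_bias_tendsto_iff[OF alpha n_alpha bias_bounds_critical[OF p]]
      by (simp only: rate_critical[OF alpha n_alpha]) simp
  next
    assume "1 / 2 + \<gamma> < s \<and> s < p"
    then have "s < p" by simp
    then have "(\<lambda>n. sqrt (real n) * bias s p (real n * \<alpha> n)) \<longlonglongrightarrow> 0
        \<longleftrightarrow> (\<lambda>n. sqrt (real n) * (real n * \<alpha> n) powr (- s / p)) \<longlonglongrightarrow> 0"
      by (intro sqrt_bias_tendsto_iff[OF alpha n_alpha bias_bounds_small[OF s]]) auto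
    also have "\<dots> \<longleftrightarrow> filterlim (\<lambda>n. real n powr (1 - p / (2 * s)) * \<alpha> n) at_top sequentially"
      by (rule rate_small[OF alpha n_alpha s p])
    finally show "(\<lambda>n. sqrt (real n) * bias s p (real n * \<alpha> n)) \<longlonglongrightarrow> 0
        \<longleftrightarrow> filterlim (\<lambda>n. real n powr (1 - p / (2 * s)) * \<alpha> n) at_top sequentially" .
  qed
qed

end
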